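(* Let $\lambda$ and $\mu$ be partitions with $\mu\subseteq\lambda$. Then for any $\tau\in S_{\ell(\mu)}$ such that $\tau(\mu)$ is defined (i.e. is a composition), \[s_{\lambda/\mu}=\sum_{\sigma\in S_{\ell(\lambda)}}\mathrm{sign}(\sigma)\,\mathrm{sign}(\tau)\,\mathfrak S^*_{\sigma(\lambda)/\tau(\mu)}.\]
   Context: For a partition (or composition) $\lambda$ with $k=\ell(\lambda)$ parts and $\sigma\in S_k$, $\sigma(\lambda)=(\lambda_{\sigma_1}+1-\sigma_1,\lambda_{\sigma_2}+2-\sigma_2,\dots,\lambda_{\sigma_k}+k-\sigma_k)$, defined only when all these entries are positive; terms with $\sigma(\lambda)$ undefined are taken to be $0$. $s_{\lambda/\mu}$ is the skew Schur function. For compositions $\alpha,\beta$, $\beta\subseteq\alpha$ means $\ell(\beta)\le\ell(\alpha)$ and $\beta_j\le\alpha_j$ for $j\le\ell(\beta)$. $\mathfrak S^*_\alpha$ is the dual immaculate function (generating function $\sum x^D$ over fillings of the diagram of $\alpha$, rows of lengths $\alpha_i$ with row 1 at bottom, whose leftmost column strictly increases bottom to top and whose rows weakly increase), $\mathfrak S_\alpha$ the dual basis of $\mathrm{NSym}$ under the pairing with $\langle\mathbf h_\alpha,M_\beta\rangle=\delta_{\alpha\beta}$, and the skew dual immaculate function is $\mathfrak S^*_{\alpha/\beta}=\sum_\gamma\langle\mathfrak S_\beta\mathbf h_\gamma,\mathfrak S^*_\alpha\rangle M_\gamma$ (sum over $\gamma\vDash|\alpha|-|\beta|$) for $\beta\subseteq\alpha$,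 and $0$ when $\beta\not\subseteq\alpha$. *)

theory Defs
  imports
    "HOL-Library.FuncSet"
    "HOL-Library.Poly_Mapping"
    "HOL-Combinatorics.Permutations"
begin

section \<open>Compositions and partitions\<close>

typedef composition = "{xs :: nat list. \<forall>x\<in>set xs. 0 < x}"
  morphisms parts Composition
  by (rule exI[of _ "[]"]) simp

lemma parts_pos: "x \<in> set (parts \<alpha>) \<Longrightarrow> 0 < x"
  using parts[of \<alpha>] by auto

text \<open>Compositions form the free monoid on the positive integers under concatenation.  Hence, in
  the library's monoid algebras, the type \<open>composition \<Rightarrow>\<^sub>0 'a\<close> is the free associative algebra over
  \<open>'a\<close> on one generator for each positive integer.\<close>

instantiation composition :: monoid_add
begin

definition zero_composition :: composition where
  "0 = Composition []"

definition plus_composition :: "composition \<Rightarrow> composition \<Rightarrow> composition" where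
  "\<alpha> + \<beta> = Composition (parts \<alpha> @ parts \<beta>)"

lemma parts_zero [simp]: "parts 0 = []"
  by (simp add: zero_composition_def Composition_inverse)

lemma parts_plus [simp]: "parts (\<alpha> + \<beta>) = parts \<alpha> @ parts \<beta>"
  using parts_pos by (auto simp: plus_composition_def intro!: Composition_inverse)

instance
  by standard (simp_all flip: parts_inject)

end

definition clength :: "composition \<Rightarrow> nat" where
  "clength \<alpha> = length (parts \<alpha>)"

definition csize :: "composition \<Rightarrow> nat" where
  "csize \<alpha> = sum_list (parts \<alpha>)"

text \<open>Parts are indexed from 0.\<close>

definition cpart :: "composition \<Rightarrow> nat \<Rightarrow> nat" where
  "cpart \<alpha> i = parts \<alpha> ! i"

definition is_partition :: "composition \<Rightarrow> bool" where
  "is_partition \<alpha> \<longleftrightarrow> sorted_wrt (\<ge>) (parts \<alpha>)"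

definition csubset :: "composition \<Rightarrow> composition \<Rightarrow> bool"  (infix \<open>\<subseteq>\<^sub>c\<close> 50) where
  "\<beta> \<subseteq>\<^sub>c \<alpha> \<longleftrightarrow> clength \<beta> \<le> clength \<alpha> \<and> (\<forall>j < clength \<beta>. cpart \<beta> j \<le> cpart \<alpha> j)"

text \<open>A permutation in \<open>S\<^sub>k\<close> is a permutation of \<open>{..<k}\<close>; moving both the positions and the values
  of \<open>\<sigma>\<close> down by 1 does not change the entries \<open>\<lambda>\<^bsub>\<sigma>\<^sub>i\<^esub> + i - \<sigma>\<^sub>i\<close>.\<close>

definition perm_entries :: "(nat \<Rightarrow> nat) \<Rightarrow> composition \<Rightarrow> int list" where
  "perm_entries \<sigma> \<alpha> =
     map (\<lambda>i. int (cpart \<alpha> (\<sigma> i)) + int i - int (\<sigma> i)) [0..<clength \<alpha>]"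

definition perm_act :: "(nat \<Rightarrow> nat) \<Rightarrow> composition \<Rightarrow> composition option" where
  "perm_act \<sigma> \<alpha> =
     (if \<forall>z\<in>set (perm_entries \<sigma> \<alpha>). 0 < z
      then Some (Composition (map nat (perm_entries \<sigma> \<alpha>))) else None)"


section \<open>Formal power series and generating functions\<close>

text \<open>A formal power series in \<open>x\<^sub>0, x\<^sub>1, \<dots>\<close> maps each exponent vector to its coefficient; the
  variables are indexed from 0.\<close>

type_synonym 'a mfps = "(nat \<Rightarrow>\<^sub>0 nat) \<Rightarrow> 'a"

text \<open>\<open>\<Sum>T\<in>A. x\<^bsup>w T\<^esup>\<close>, for \<open>A\<close> with finitely many elements of each weight.\<close>

definition gen_fun :: "'t set \<Rightarrow> ('t \<Rightarrow> nat \<Rightarrow>\<^sub>0 nat) \<Rightarrow> 'a::comm_ring_1 mfps" where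
  "gen_fun A w = (\<lambda>m. of_nat (card {T \<in> A. w T = m}))"

text \<open>Cells are (row, column), rows counted from the bottom.\<close>

definition diagram :: "composition \<Rightarrow> (nat \<times> nat) set" where
  "diagram \<alpha> = {(i, j). i < clength \<alpha> \<and> j < cpart \<alpha> i}"

definition weight :: "(nat \<times> nat) set \<Rightarrow> (nat \<times> nat \<Rightarrow> nat) \<Rightarrow> nat \<Rightarrow>\<^sub>0 nat" where
  "weight D T = (\<Sum>c\<in>D. Poly_Mapping.single (T c) 1)"

definition ssyt :: "(nat \<times> nat) set \<Rightarrow> (nat \<times> nat \<Rightarrow> nat) set" where
  "ssyt D = {T \<in> D \<rightarrow>\<^sub>E UNIV.
     (\<forall>i j j'. (i, j) \<in> D \<longrightarrow> (i, j') \<in> D \<longrightarrow> j < j' \<longrightarrow> T (i, j) \<le> T (i, j')) \<and>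
     (\<forall>i i' j. (i, j) \<in> D \<longrightarrow> (i', j) \<in> D \<longrightarrow> i < i' \<longrightarrow> T (i, j) < T (i', j))}"

definition skew_schur :: "composition \<Rightarrow> composition \<Rightarrow> 'a::comm_ring_1 mfps" where
  "skew_schur \<alpha> \<beta> = gen_fun (ssyt (diagram \<alpha> - diagram \<beta>)) (weight (diagram \<alpha> - diagram \<beta>))"

definition immaculate_tableaux :: "composition \<Rightarrow> (nat \<times> nat \<Rightarrow> nat) set" where
  "immaculate_tableaux \<alpha> = {T \<in> diagram \<alpha> \<rightarrow>\<^sub>E UNIV.
     (\<forall>i j j'. (i, j) \<in> diagram \<alpha> \<longrightarrow> (i, j') \<in> diagram \<alpha> \<longrightarrow> j < j' \<longrightarrow> T (i, j) \<le> T (i, j')) \<and>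
     (\<forall>i i'. (i, 0) \<in> diagram \<alpha> \<longrightarrow> (i', 0) \<in> diagram \<alpha> \<longrightarrow> i < i' \<longrightarrow> T (i, 0) < T (i', 0))}"

definition dual_immaculate :: "composition \<Rightarrow> 'a::comm_ring_1 mfps" where
  "dual_immaculate \<alpha> = gen_fun (immaculate_tableaux \<alpha>) (weight (diagram \<alpha>))"


section \<open>Quasisymmetric functions, NSym and the pairing\<close>

definition mon_vec :: "composition \<Rightarrow> nat list \<Rightarrow> nat \<Rightarrow>\<^sub>0 nat" where
  "mon_vec \<alpha> is = (\<Sum>j<clength \<alpha>. Poly_Mapping.single (is ! j) (cpart \<alpha> j))"

text \<open>\<open>M\<^sub>\<alpha>\<close> is the sum of \<open>x\<^bsub>i\<^sub>1\<^esub>\<^bsup>\<alpha>\<^sub>1\<^esup> \<dots> x\<^bsub>i\<^sub>k\<^esub>\<^bsup>\<alpha>\<^sub>k\<^esup>\<close> over all \<open>i\<^sub>1 < \<dots> < i\<^sub>k\<close>.\<close>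

definition monomial_qsym :: "composition \<Rightarrow> 'a::comm_ring_1 mfps" where
  "monomial_qsym \<alpha> = gen_fun {is. length is = clength \<alpha> \<and> sorted_wrt (<) is} (mon_vec \<alpha>)"

definition qsym_comb :: "(composition \<Rightarrow>\<^sub>0 'a::comm_ring_1) \<Rightarrow> 'a mfps" where
  "qsym_comb c = (\<lambda>m. \<Sum>\<beta>\<in>Poly_Mapping.keys c. Poly_Mapping.lookup c \<beta> * monomial_qsym \<beta> m)"

text \<open>The coordinates of a quasisymmetric function in the basis \<open>M\<close>; unspecified on power series that
  are not quasisymmetric.\<close>

definition M_coords :: "'a::comm_ring_1 mfps \<Rightarrow> composition \<Rightarrow>\<^sub>0 'a" where
  "M_coords F = (THE c. F = qsym_comb c)"

type_synonym 'a nsym = "composition \<Rightarrow>\<^sub>0 'a"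

definition h :: "composition \<Rightarrow> 'a::comm_ring_1 nsym" where
  "h \<alpha> = Poly_Mapping.single \<alpha> 1"

lemma h_mult: "h \<alpha> * h \<beta> = h (\<alpha> + \<beta>)"
  by (simp add: h_def mult_single)

text \<open>The bilinear form with \<open>\<langle>h\<^sub>\<alpha>, M\<^sub>\<beta>\<rangle> = \<delta>\<^bsub>\<alpha>\<beta>\<^esub>\<close>; see \<open>pairing_h_M\<close> below.\<close>

definition pairing :: "'a::comm_ring_1 nsym \<Rightarrow> 'a mfps \<Rightarrow> 'a" where
  "pairing H F =
     (\<Sum>\<alpha>\<in>Poly_Mapping.keys H. Poly_Mapping.lookup H \<alpha> * Poly_Mapping.lookup (M_coords F) \<alpha>)"

definition immaculate :: "composition \<Rightarrow> 'a::comm_ring_1 nsym" where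
  "immaculate \<alpha> = (THE H. \<forall>\<beta>. pairing H (dual_immaculate \<beta>) = (if \<alpha> = \<beta> then 1 else 0))"

definition skew_dual_immaculate :: "composition \<Rightarrow> composition \<Rightarrow> 'a::comm_ring_1 mfps" where
  "skew_dual_immaculate \<alpha> \<beta> =
     (if \<beta> \<subseteq>\<^sub>c \<alpha>
      then (\<lambda>m. \<Sum>\<gamma> | csize \<gamma> = csize \<alpha> - csize \<beta>.
              pairing (immaculate \<beta> * h \<gamma>) (dual_immaculate \<alpha>) * monomial_qsym \<gamma> m)
      else (\<lambda>m. 0))"


section \<open>Well-definedness of the sums and of the coordinates\<close>

lemma finite_csize: "finite {\<gamma>. csize \<gamma> = n}"
proof -
  have len: "length xs \<le> sum_list xs" if "\<forall>x\<in>set xs. 0 < x" for xs :: "nat list"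
    using that by (induction xs) auto
  have "parts ` {\<gamma>. csize \<gamma> = n} \<subseteq> {xs. set xs \<subseteq> {..n} \<and> length xs \<le> n}"
  proof clarify
    fix \<gamma> assume "n = csize \<gamma>"
    then show "set (parts \<gamma>) \<subseteq> {..csize \<gamma>} \<and> length (parts \<gamma>) \<le> csize \<gamma>"
      using len[of "parts \<gamma>"] parts_pos member_le_sum_list by (auto simp: csize_def)
  qed
  moreover have "finite {xs. set xs \<subseteq> {..n} \<and> length xs \<le> n}"
    by (rule finite_lists_length_le) simp
  ultimately show ?thesis
    by (meson finite_subset finite_imageD inj_onI parts_inject)
qed

lemma finite_diagram: "finite (diagram \<alpha>)"
proof -
  have "diagram \<alpha> = (SIGMA i:{..<clength \<alpha>}. {..<cpart \<alpha> i})"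
    by (auto simp: diagram_def)
  then show ?thesis by simp
qed

lemma finite_fillings_weight:
  assumes "finite D"
  shows "finite {T \<in> D \<rightarrow>\<^sub>E UNIV. weight D T = m}"
proof -
  have "T c \<in> Poly_Mapping.keys (weight D T)" if "c \<in> D" for T c
  proof -
    have "Poly_Mapping.lookup (weight D T) (T c) =
        (\<Sum>d\<in>D. Poly_Mapping.lookup (Poly_Mapping.single (T d) (1::nat)) (T c))"
      by (simp add: weight_def lookup_sum)
    also have "\<dots> \<ge> Poly_Mapping.lookup (Poly_Mapping.single (T c) 1) (T c)"
      using that assms by (intro member_le_sum) auto
    finally show ?thesis by (simp add: in_keys_iff)
  qed
  then have "{T \<in> D \<rightarrow>\<^sub>E UNIV. weight D T = m} \<subseteq> D \<rightarrow>\<^sub>E Poly_Mapping.keys m"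
    by auto
  moreover have "finite (D \<rightarrow>\<^sub>E Poly_Mapping.keys m)"
    using assms by (intro finite_PiE) auto
  ultimately show ?thesis by (rule finite_subset)
qed

lemma lookup_mon_vec:
  assumes "length is = clength \<alpha>" "distinct is" "j < clength \<alpha>"
  shows "Poly_Mapping.lookup (mon_vec \<alpha> is) (is ! j) = cpart \<alpha> j"
proof -
  have "Poly_Mapping.lookup (mon_vec \<alpha> is) (is ! j) =
      (\<Sum>i<clength \<alpha>. if i = j then cpart \<alpha> i else 0)"
    unfolding mon_vec_def lookup_sum
    using assms by (intro sum.cong) (auto simp: lookup_single when_def nth_eq_iff_index_eq)
  then show ?thesis using assms by simp
qed

lemma keys_mon_vec:
  assumes "length is = clength \<alpha>" "distinct is"
  shows "Poly_Mapping.keys (mon_vec \<alpha> is) = set is"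
proof
  show "Poly_Mapping.keys (mon_vec \<alpha> is) \<subseteq> set is"
  proof
    fix k assume k: "k \<in> Poly_Mapping.keys (mon_vec \<alpha> is)"
    show "k \<in> set is"
    proof (rule ccontr)
      assume "k \<notin> set is"
      then have "Poly_Mapping.lookup (mon_vec \<alpha> is) k = 0"
        unfolding mon_vec_def lookup_sum using assms
        by (intro sum.neutral) (auto simp: lookup_single when_def)
      with k show False by (simp add: in_keys_iff)
    qed
  qed
  show "set is \<subseteq> Poly_Mapping.keys (mon_vec \<alpha> is)"
  proof
    fix k assume "k \<in> set is"
    then obtain j where "j < clength \<alpha>" "k = is ! j"
      using assms by (metis in_set_conv_nth)
    moreover from this have "0 < cpart \<alpha> j"
      using parts_pos[OF nth_mem] by (simp add: cpart_def clength_def)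
    ultimately show "k \<in> Poly_Mapping.keys (mon_vec \<alpha> is)"
      using lookup_mon_vec[OF assms] by (simp add: in_keys_iff)
  qed
qed

lemma monomial_qsym_coeff:
  "monomial_qsym \<beta> (mon_vec \<alpha> [0..<clength \<alpha>]) = (if \<alpha> = \<beta> then 1 else (0 :: 'a::comm_ring_1))"
proof -
  let ?S = "{is \<in> {is. length is = clength \<beta> \<and> sorted_wrt (<) is}.
              mon_vec \<beta> is = mon_vec \<alpha> [0..<clength \<alpha>]}"
  have *: "is = [0..<clength \<alpha>] \<and> \<alpha> = \<beta>"
    if l: "length is = clength \<beta>" and s: "sorted_wrt (<) is"
      and e: "mon_vec \<beta> is = mon_vec \<alpha> [0..<clength \<alpha>]" for "is"
  proof -
    have d: "distinct is" and s': "sorted is"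
      using s by (simp_all add: strict_sorted_iff)
    have "set is = set [0..<clength \<alpha>]"
      using keys_mon_vec[OF l d] keys_mon_vec[of "[0..<clength \<alpha>]" \<alpha>] e by simp
    then have i: "is = [0..<clength \<alpha>]"
      using d s' by (intro sorted_distinct_set_unique) auto
    then have len: "clength \<alpha> = clength \<beta>" using l by simp
    have "cpart \<alpha> j = cpart \<beta> j" if "j < clength \<alpha>" for j
      using lookup_mon_vec[OF l d, of j] lookup_mon_vec[of "[0..<clength \<alpha>]" \<alpha> j] that i e len
      by simp
    then have "parts \<alpha> = parts \<beta>"
      using len by (intro nth_equalityI) (auto simp: clength_def cpart_def)
    with i show ?thesis by (simp add: parts_inject)
  qed
  have "?S = (if \<alpha> = \<beta> then {[0..<clength \<alpha>]} else {})"
    using * by auto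
  then show ?thesis
    by (simp add: monomial_qsym_def gen_fun_def)
qed

lemma qsym_comb_coeff:
  "qsym_comb c (mon_vec \<alpha> [0..<clength \<alpha>]) = Poly_Mapping.lookup c \<alpha>"
proof -
  have "qsym_comb c (mon_vec \<alpha> [0..<clength \<alpha>]) =
      (\<Sum>\<beta>\<in>Poly_Mapping.keys c. if \<beta> = \<alpha> then Poly_Mapping.lookup c \<beta> else 0)"
    unfolding qsym_comb_def by (intro sum.cong) (auto simp: monomial_qsym_coeff)
  then show ?thesis by (auto simp: in_keys_iff)
qed

lemma M_coords_qsym_comb: "M_coords (qsym_comb c) = c"
  unfolding M_coords_def
proof (rule the_equality)
  fix c' assume "qsym_comb c = qsym_comb c'"
  then show "c' = c"
    by (intro poly_mapping_eqI) (metis qsym_comb_coeff)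
qed simp

lemma pairing_h_M: "pairing (h \<alpha>) (monomial_qsym \<beta>) = (if \<alpha> = \<beta> then 1 else (0 :: 'a::comm_ring_1))"
proof -
  have "monomial_qsym \<beta> = qsym_comb (Poly_Mapping.single \<beta> (1 :: 'a))"
    by (simp add: qsym_comb_def)
  then have "M_coords (monomial_qsym \<beta>) = Poly_Mapping.single \<beta> (1 :: 'a)"
    by (simp add: M_coords_qsym_comb)
  then show ?thesis
    by (auto simp: pairing_def h_def lookup_single)
qed

end

theory Submission
  imports Defs
begin

text \<open>Both sides count chains of compositions. Removing the largest entry again and again turns a
  semistandard tableau into a chain of horizontal strips, and an immaculate tableau into a chain of
  steps in which rows grow and at most one new row appears on top. The tableau count is
  unitriangular, so the immaculate basis exists, and duality alone then gives the right Pieri rule: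
  the coefficient of \<open>M\<^sub>\<gamma>\<close> in a skew dual immaculate function counts immaculate chains with
  step sizes \<open>\<gamma>\<close>.

  It remains to compare, one step at a time, the alternating sum of immaculate steps from \<open>\<delta>\<close> into
  \<open>\<sigma>(la)\<close> with horizontal strips. The condition for such a step is
  \<open>\<delta>\<^sub>j - j \<le> la\<^bsub>\<sigma>(j)\<^esub> - \<sigma>(j)\<close> for all \<open>j\<close>, that is, \<open>\<sigma>(j) < c\<^sub>j\<close> for certain bounds \<open>c\<^sub>j\<close>, because
  \<open>la\<^sub>i - i\<close> is strictly decreasing. If two bounds coincide, or one vanishes, the sum is 0. Otherwise
  \<open>c\<^sub>j = \<pi>(j) + 1\<close> for a permutation \<open>\<pi>\<close>, only \<open>\<sigma> = \<pi>\<close> contributes, and \<open>\<delta> = \<pi>(\<rho>)\<close> for a partition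
  \<open>\<rho>\<close> such that \<open>la/\<rho>\<close> is a horizontal strip.\<close>

section \<open>Diagrams\<close>

lemma diagram_iff: "(i, j) \<in> diagram \<alpha> \<longleftrightarrow> i < clength \<alpha> \<and> j < cpart \<alpha> i"
  by (simp add: diagram_def)

lemma cpart_pos: "i < clength \<alpha> \<Longrightarrow> 0 < cpart \<alpha> i"
  unfolding clength_def cpart_def using nth_mem parts_pos by blast

lemma diagram_0 [simp]: "diagram 0 = {}"
  by (simp add: diagram_def clength_def)

lemma diagram_col0: "(i, 0) \<in> diagram \<alpha> \<longleftrightarrow> i < clength \<alpha>"
  by (auto simp: diagram_iff cpart_pos)

lemma diagram_Sigma: "diagram \<alpha> = (SIGMA i:{..<clength \<alpha>}. {..<cpart \<alpha> i})"
  by (auto simp: diagram_def)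

lemma csize_eq_sum: "csize \<alpha> = (\<Sum>i<clength \<alpha>. cpart \<alpha> i)"
  by (simp add: csize_def clength_def cpart_def sum_list_sum_nth atLeast0LessThan)

lemma card_diagram: "card (diagram \<alpha>) = csize \<alpha>"
  by (simp add: diagram_Sigma csize_eq_sum)

lemma composition_eqI:
  assumes "clength \<alpha> = clength \<beta>" "\<And>i. i < clength \<alpha> \<Longrightarrow> cpart \<alpha> i = cpart \<beta> i"
  shows "\<alpha> = \<beta>"
proof -
  have "parts \<alpha> = parts \<beta>"
    using assms by (intro nth_equalityI) (simp_all add: clength_def cpart_def)
  then show ?thesis by (simp add: parts_inject)
qed

text \<open>Column 0 records the number of rows, and the last cell of each row its length.
  Containment can therefore be handled throughout as inclusion of cell sets.\<close>

lemma diagram_subset_iff: "diagram \<beta> \<subseteq> diagram \<alpha> \<longleftrightarrow> \<beta> \<subseteq>\<^sub>c \<alpha>"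
proof
  assume s: "diagram \<beta> \<subseteq> diagram \<alpha>"
  have len: "i < clength \<alpha>" if "i < clength \<beta>" for i
    using s that by (auto simp flip: diagram_col0)
  have "cpart \<beta> i \<le> cpart \<alpha> i" if i: "i < clength \<beta>" for i
  proof -
    have "(i, cpart \<beta> i - 1) \<in> diagram \<beta>"
      using i cpart_pos[OF i] by (simp add: diagram_iff)
    with s have "(i, cpart \<beta> i - 1) \<in> diagram \<alpha>" by blast
    then show ?thesis by (simp add: diagram_iff) linarith
  qed
  with len show "\<beta> \<subseteq>\<^sub>c \<alpha>"
    by (meson csubset_def leI less_irrefl)
next
  assume "\<beta> \<subseteq>\<^sub>c \<alpha>"
  then show "diagram \<beta> \<subseteq> diagram \<alpha>"
    by (fastforce simp: csubset_def diagram_iff)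
qed

lemma diagram_inject: "diagram \<alpha> = diagram \<beta> \<Longrightarrow> \<alpha> = \<beta>"
  using diagram_subset_iff[of \<alpha> \<beta>] diagram_subset_iff[of \<beta> \<alpha>]
  by (intro composition_eqI) (auto simp: csubset_def intro!: antisym)

lemma parts_Composition: "(\<And>x. x \<in> set xs \<Longrightarrow> 0 < x) \<Longrightarrow> parts (Composition xs) = xs"
  by (simp add: Composition_inverse)

lemma ex_composition:
  assumes "\<And>i. i < n \<Longrightarrow> 0 < f i"
  obtains \<alpha> where "clength \<alpha> = n" "\<And>i. i < n \<Longrightarrow> cpart \<alpha> i = f i"
proof -
  have "parts (Composition (map f [0..<n])) = map f [0..<n]"
    using assms by (intro parts_Composition) auto
  then show ?thesis
    by (intro that[of "Composition (map f [0..<n])"]) (simp_all add: clength_def cpart_def)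
qed

text \<open>The least number outside \<open>S\<close> bounds it. Both row lengths and the bounds on
  permutations are obtained as cardinalities in this way.\<close>

lemma down_closed_eq_lessThan:
  assumes "finite (S :: nat set)" "\<And>i j. i \<in> S \<Longrightarrow> j < i \<Longrightarrow> j \<in> S"
  shows "S = {..<card S}"
proof -
  define n where "n = (LEAST n. n \<notin> S)"
  have "\<exists>n. n \<notin> S" using ex_new_if_finite[OF infinite_UNIV_nat assms(1)] .
  then have "n \<notin> S" unfolding n_def by (rule LeastI_ex)
  then have "i < n" if "i \<in> S" for i
    using assms(2)[OF that, of n] that by (metis nat_neq_iff)
  moreover have "i \<in> S" if "i < n" for i
    using not_less_Least[of i "\<lambda>n. n \<notin> S"] that by (simp add: n_def)
  ultimately have "S = {..<n}" by auto
  then show ?thesis by auto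
qed

text \<open>This recognizes the cell sets of compositions: rows are left-justified and column 0 has
  no gap, while other columns may have gaps because parts come in any order. It supplies the inner
  shape when the largest entries of a tableau are removed.\<close>

lemma ex_diagram:
  assumes fin: "finite X"
    and row: "\<And>i j j'. (i, j) \<in> X \<Longrightarrow> j' < j \<Longrightarrow> (i, j') \<in> X"
    and col: "\<And>i i'. (i, 0) \<in> X \<Longrightarrow> i' < i \<Longrightarrow> (i', 0) \<in> X"
  obtains \<delta> where "diagram \<delta> = X"
proof -
  define f where "f i = card {j. (i, j) \<in> X}" for i
  define n where "n = card {i. (i, 0) \<in> X}"
  have f: "(i, j) \<in> X \<longleftrightarrow> j < f i" for i j
  proof -
    have "finite {j. (i, j) \<in> X}"
      by (rule finite_subset[of _ "snd ` X"]) (use fin in force)+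
    then have "{j. (i, j) \<in> X} = {..<f i}"
      unfolding f_def using row by (intro down_closed_eq_lessThan) auto
    then show ?thesis by auto
  qed
  have n: "(i, 0) \<in> X \<longleftrightarrow> i < n" for i
  proof -
    have "finite {i. (i, 0) \<in> X}"
      by (rule finite_subset[of _ "fst ` X"]) (use fin in force)+
    then have "{i. (i, 0) \<in> X} = {..<n}"
      unfolding n_def using col by (intro down_closed_eq_lessThan) auto
    then show ?thesis by auto
  qed
  obtain \<delta> where \<delta>: "clength \<delta> = n" "\<And>i. i < n \<Longrightarrow> cpart \<delta> i = f i"
    using ex_composition[of n f] n f by blast
  have "(i, j) \<in> diagram \<delta> \<longleftrightarrow> (i, j) \<in> X" for i j
    using \<delta> f[of i j] f[of i 0] n[of i] by (cases "i < n") (auto simp: diagram_iff)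
  then show ?thesis by (intro that) auto
qed


section \<open>Strips and chains\<close>

text \<open>The set \<open>J\<close> holds the columns in which fillings must increase strictly, so
  that semistandard tableaux (\<open>J = UNIV\<close>) and immaculate tableaux
  (\<open>J = {0}\<close>) share one development. The predicate is the condition on shapes that
  makes removal of the largest entry work; it singles out the partitions for \<open>UNIV\<close> and
  holds for every composition for \<open>{0}\<close>.\<close>

definition columns_closed :: "nat set \<Rightarrow> composition \<Rightarrow> bool" where
  "columns_closed J \<alpha> \<longleftrightarrow>
     (\<forall>j\<in>J. \<forall>i i'. i < i' \<longrightarrow> (i', j) \<in> diagram \<alpha> \<longrightarrow> (i, j) \<in> diagram \<alpha>)"

text \<open>For \<open>J = UNIV\<close> and partitions these are the horizontal strips; for \<open>J = {0}\<close> the relation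
  of the right Pieri rule for immaculate functions.\<close>

definition strip_step :: "nat set \<Rightarrow> nat \<Rightarrow> composition \<Rightarrow> composition \<Rightarrow> bool" where
  "strip_step J n \<delta> \<alpha> \<longleftrightarrow> diagram \<delta> \<subseteq> diagram \<alpha> \<and> csize \<alpha> = csize \<delta> + n \<and>
     (\<forall>j\<in>J. \<forall>i i'. i < i' \<longrightarrow> (i', j) \<in> diagram \<alpha> \<longrightarrow> (i, j) \<in> diagram \<delta>)"

text \<open>The list holds the sizes of the strips from the last one to the first.\<close>

primrec chains :: "nat set \<Rightarrow> composition \<Rightarrow> nat list \<Rightarrow> composition \<Rightarrow> nat" where
  "chains J \<beta> [] \<alpha> = (if \<alpha> = \<beta> then 1 else 0)"
| "chains J \<beta> (n # g) \<alpha> = (\<Sum>\<delta> | strip_step J n \<delta> \<alpha>. chains J \<beta> g \<delta>)"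

lemma columns_closed_0: "columns_closed {0} \<alpha>"
  by (auto simp: columns_closed_def diagram_col0)

lemma columns_closed_UNIV: "is_partition \<alpha> \<longleftrightarrow> columns_closed UNIV \<alpha>"
proof
  assume "is_partition \<alpha>"
  then have "cpart \<alpha> i' \<le> cpart \<alpha> i" if "i < i'" "i' < clength \<alpha>" for i i'
    using that by (simp add: is_partition_def sorted_wrt_iff_nth_less clength_def cpart_def)
  then show "columns_closed UNIV \<alpha>"
    unfolding columns_closed_def diagram_iff by (meson less_trans order_less_le_trans)
next
  assume c: "columns_closed UNIV \<alpha>"
  have "cpart \<alpha> i' \<le> cpart \<alpha> i" if "i < i'" "i' < clength \<alpha>" for i i'
  proof -
    have "(i', cpart \<alpha> i' - 1) \<in> diagram \<alpha>"
      using that cpart_pos[of i' \<alpha>] by (simp add: diagram_iff)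
    then have "(i, cpart \<alpha> i' - 1) \<in> diagram \<alpha>"
      using c that unfolding columns_closed_def by blast
    then show ?thesis by (simp add: diagram_iff) linarith
  qed
  then show "is_partition \<alpha>"
    by (auto simp: is_partition_def sorted_wrt_iff_nth_less clength_def cpart_def)
qed

lemma strip_step_closed:
  "strip_step J n \<delta> \<alpha> \<Longrightarrow> columns_closed J \<alpha> \<Longrightarrow> columns_closed J \<delta>"
  unfolding strip_step_def columns_closed_def by blast

lemma finite_strip_step: "finite {\<delta>. strip_step J n \<delta> \<alpha>}"
  by (rule finite_subset[OF _ finite_csize[of "csize \<alpha> - n"]]) (auto simp: strip_step_def)

lemma chains_Cons_nonzeroE:
  assumes "chains J \<beta> (n # g) \<alpha> \<noteq> 0"
  obtains \<delta> where "strip_step J n \<delta> \<alpha>" "chains J \<beta> g \<delta> \<noteq> 0"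
  using assms unfolding chains.simps
  by (rule sum.not_neutral_contains_not_neutral) (use that in blast)

text \<open>Chains only grow, each step by its prescribed size. Thus shapes that miss
  \<open>\<beta>\<close> or have the wrong size count zero, and sums over strips need no side
  conditions.\<close>

lemma chains_nonzero:
  "chains J \<beta> g \<alpha> \<noteq> 0 \<Longrightarrow> diagram \<beta> \<subseteq> diagram \<alpha> \<and> csize \<alpha> = csize \<beta> + sum_list g"
proof (induction g arbitrary: \<alpha>)
  case (Cons n g)
  then obtain \<delta> where "strip_step J n \<delta> \<alpha>" "chains J \<beta> g \<delta> \<noteq> 0"
    by (elim chains_Cons_nonzeroE)
  with Cons.IH[of \<delta>] show ?case by (auto simp: strip_step_def)
qed (auto split: if_splits)


section \<open>Tableaux as chains\<close>

definition tableaux :: "nat set \<Rightarrow> (nat \<times> nat) set \<Rightarrow> (nat \<times> nat \<Rightarrow> nat) set" where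
  "tableaux J D = {T \<in> D \<rightarrow>\<^sub>E UNIV.
     (\<forall>i j j'. (i, j) \<in> D \<longrightarrow> (i, j') \<in> D \<longrightarrow> j < j' \<longrightarrow> T (i, j) \<le> T (i, j')) \<and>
     (\<forall>i i'. \<forall>j\<in>J. (i, j) \<in> D \<longrightarrow> (i', j) \<in> D \<longrightarrow> i < i' \<longrightarrow> T (i, j) < T (i', j))}"

lemma tableauxI:
  assumes "\<And>c. c \<notin> D \<Longrightarrow> T c = undefined"
    and "\<And>i j j'. (i, j) \<in> D \<Longrightarrow> (i, j') \<in> D \<Longrightarrow> j < j' \<Longrightarrow> T (i, j) \<le> T (i, j')"
    and "\<And>i i' j. j \<in> J \<Longrightarrow> (i, j) \<in> D \<Longrightarrow> (i', j) \<in> D \<Longrightarrow> i < i' \<Longrightarrow> T (i, j) < T (i', j)"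
  shows "T \<in> tableaux J D"
  using assms unfolding tableaux_def by (blast intro: PiE_I)

lemma tableauxD:
  assumes "T \<in> tableaux J D"
  shows "c \<notin> D \<Longrightarrow> T c = undefined"
    and "(i, j) \<in> D \<Longrightarrow> (i, j') \<in> D \<Longrightarrow> j < j' \<Longrightarrow> T (i, j) \<le> T (i, j')"
    and "j \<in> J \<Longrightarrow> (i, j) \<in> D \<Longrightarrow> (i', j) \<in> D \<Longrightarrow> i < i' \<Longrightarrow> T (i, j) < T (i', j)"
  using assms unfolding tableaux_def by (blast intro: PiE_arb)+

lemma ssyt_tableaux: "ssyt D = tableaux UNIV D"
  by (auto simp: ssyt_def tableaux_def)

lemma immaculate_tableaux_tableaux:
  "immaculate_tableaux \<alpha> = tableaux {0} (diagram \<alpha> - diagram 0)"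
  by (simp add: immaculate_tableaux_def tableaux_def)

lemma keys_weight:
  assumes "finite D"
  shows "Poly_Mapping.keys (weight D T) = T ` D"
proof -
  have "Poly_Mapping.lookup (weight D T) x = card {c \<in> D. T c = x}" for x
  proof -
    have "Poly_Mapping.lookup (weight D T) x = (\<Sum>c\<in>D. if T c = x then 1 else 0)"
      unfolding weight_def lookup_sum by (auto simp: lookup_single when_def intro!: sum.cong)
    also have "\<dots> = card {c \<in> D. T c = x}"
      using assms by (simp flip: sum.inter_filter)
    finally show ?thesis .
  qed
  then have "x \<in> Poly_Mapping.keys (weight D T) \<longleftrightarrow> {c \<in> D. T c = x} \<noteq> {}" for x
    using assms by (simp add: in_keys_iff)
  then show ?thesis by (auto simp: set_eq_iff)
qed

lemma weight_Un:
  assumes "finite D" "finite E" "D \<inter> E = {}"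
  shows "weight (D \<union> E) T = weight D T + weight E T"
  unfolding weight_def using assms by (rule sum.union_disjoint)

lemma weight_const: "(\<And>c. c \<in> D \<Longrightarrow> T c = k) \<Longrightarrow> weight D T = Poly_Mapping.single k (card D)"
proof -
  assume "\<And>c. c \<in> D \<Longrightarrow> T c = k"
  then have "weight D T = (\<Sum>c\<in>D. Poly_Mapping.single k 1)"
    unfolding weight_def by (intro sum.cong) auto
  also have "\<dots> = Poly_Mapping.single k (card D)"
    by (induction D rule: infinite_finite_induct) (simp_all del: sum_constant flip: single_add)
  finally show ?thesis .
qed

lemma weight_cong: "(\<And>c. c \<in> D \<Longrightarrow> T c = U c) \<Longrightarrow> weight D T = weight D U"
  unfolding weight_def by (intro sum.cong) auto

text \<open>The cells with the largest entry \<open>k\<close> form a strip.\<close>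

lemma card_tableaux_peel:
  assumes J: "0 \<in> J" and \<alpha>: "columns_closed J \<alpha>" and \<beta>: "columns_closed J \<beta>"
    and sub: "diagram \<beta> \<subseteq> diagram \<alpha>"
    and less: "\<And>x. x \<in> Poly_Mapping.keys m \<Longrightarrow> x < k"
  shows "card {T \<in> tableaux J (diagram \<alpha> - diagram \<beta>).
           weight (diagram \<alpha> - diagram \<beta>) T = m + Poly_Mapping.single k n} =
    (\<Sum>\<delta> | strip_step J n \<delta> \<alpha> \<and> diagram \<beta> \<subseteq> diagram \<delta>.
       card {T \<in> tableaux J (diagram \<delta> - diagram \<beta>). weight (diagram \<delta> - diagram \<beta>) T = m})"
    (is "card ?A = (\<Sum>\<delta>\<in>?I. card (?B \<delta>))")
proof -
  let ?D = "\<lambda>\<delta>. diagram \<delta> - diagram \<beta>"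
  \<comment> \<open>\<open>f\<close> extends a filling of the inner skew shape by the entry
    \<open>k\<close> on the remaining strip; its inverse keeps the cells with entries below
    \<open>k\<close>.\<close>
  define f where "f = (\<lambda>(\<delta>, T) c. if c \<in> ?D \<delta> then T c else if c \<in> ?D \<alpha> then k else undefined)"
  have fin[simp]: "finite (?D \<delta>)" "finite (diagram \<delta>)" for \<delta>
    by (simp_all add: finite_diagram)
  have ent: "T c < k" if "T \<in> ?B \<delta>" "c \<in> ?D \<delta>" for T \<delta> c
    using that less keys_weight[OF fin(1)[of \<delta>], of T] by auto
  have wt: "weight (?D \<alpha>) T = weight (?D \<delta>) T + Poly_Mapping.single k (card (diagram \<alpha> - diagram \<delta>))"
    if s: "diagram \<beta> \<subseteq> diagram \<delta>" "diagram \<delta> \<subseteq> diagram \<alpha>"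
      and k: "\<And>c. c \<in> diagram \<alpha> - diagram \<delta> \<Longrightarrow> T c = k" for T \<delta>
  proof -
    have "?D \<alpha> = ?D \<delta> \<union> (diagram \<alpha> - diagram \<delta>)" using s by auto
    moreover have "?D \<delta> \<inter> (diagram \<alpha> - diagram \<delta>) = {}" by auto
    ultimately have "weight (?D \<alpha>) T = weight (?D \<delta>) T + weight (diagram \<alpha> - diagram \<delta>) T"
      using weight_Un[of "?D \<delta>" "diagram \<alpha> - diagram \<delta>" T] by simp
    then show ?thesis using weight_const[of "diagram \<alpha> - diagram \<delta>" T k] k by simp
  qed
  have card_diff: "card (diagram \<alpha> - diagram \<delta>) = csize \<alpha> - csize \<delta>"
    if "diagram \<delta> \<subseteq> diagram \<alpha>" for \<delta>
    using that by (simp add: card_Diff_subset card_diagram)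
  have "bij_betw f (Sigma ?I ?B) ?A"
    unfolding bij_betw_def
  proof
    show "inj_on f (Sigma ?I ?B)"
    proof (rule inj_onI, clarify)
      fix \<delta> T \<epsilon> U
      assume s: "strip_step J n \<delta> \<alpha>" "diagram \<beta> \<subseteq> diagram \<delta>"
          "strip_step J n \<epsilon> \<alpha>" "diagram \<beta> \<subseteq> diagram \<epsilon>"
        and T: "T \<in> tableaux J (?D \<delta>)" "m = weight (?D \<delta>) T"
        and U: "U \<in> tableaux J (?D \<epsilon>)" "weight (?D \<epsilon>) U = weight (?D \<delta>) T"
        and eq: "f (\<delta>, T) = f (\<epsilon>, U)"
      have TB: "T \<in> ?B \<delta>" "U \<in> ?B \<epsilon>" using T U by auto
      \<comment> \<open>Entries of the inner filling are below \<open>k\<close> and all added ones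
        equal \<open>k\<close>, so the glued filling determines the inner shape.\<close>
      have "c \<in> ?D \<delta> \<longleftrightarrow> c \<in> ?D \<epsilon>" if c: "c \<in> ?D \<alpha>" for c
        using fun_cong[OF eq, of c] c ent[OF TB(1), of c] ent[OF TB(2), of c]
        by (auto simp: f_def split: if_splits)
      moreover have "?D \<delta> \<subseteq> ?D \<alpha>" "?D \<epsilon> \<subseteq> ?D \<alpha>" using s by (auto simp: strip_step_def)
      ultimately have D: "?D \<delta> = ?D \<epsilon>" by blast
      then have "diagram \<delta> = diagram \<epsilon>" using s by auto
      then have \<delta>: "\<delta> = \<epsilon>" by (rule diagram_inject)
      have "T c = U c" for c
      proof (cases "c \<in> ?D \<delta>")
        case True
        then show ?thesis using fun_cong[OF eq, of c] by (simp add: f_def \<delta>)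
      next
        case False
        then show ?thesis using tableauxD(1)[OF T(1)] tableauxD(1)[OF U(1)] \<delta> by metis
      qed
      with \<delta> show "\<delta> = \<epsilon> \<and> T = U" by auto
    qed
    show "f ` Sigma ?I ?B = ?A"
    proof (intro equalityI subsetI)
      fix V assume "V \<in> f ` Sigma ?I ?B"
      then obtain \<delta> T where s: "strip_step J n \<delta> \<alpha>" "diagram \<beta> \<subseteq> diagram \<delta>"
        and TB: "T \<in> ?B \<delta>" and V: "V = f (\<delta>, T)" by auto
      have T: "T \<in> tableaux J (?D \<delta>)" "weight (?D \<delta>) T = m" using TB by auto
      have D: "diagram \<delta> \<subseteq> diagram \<alpha>" using s by (auto simp: strip_step_def)
      have V1: "V c = T c" if "c \<in> ?D \<delta>" for c using that by (simp add: V f_def)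
      have V2: "V c = k" if "c \<in> diagram \<alpha> - diagram \<delta>" for c
        using that s by (auto simp: V f_def)
      have w: "weight (?D \<alpha>) V = m + Poly_Mapping.single k n"
        using wt[of \<delta> V] V2 s D weight_cong[of "?D \<delta>" V T] V1 T card_diff[OF D]
        by (simp add: strip_step_def)
      have "V c = undefined" if "c \<notin> ?D \<alpha>" for c
        using D that by (auto simp: V f_def)
      moreover have "V (i, j) \<le> V (i, j')"
        if "(i, j) \<in> ?D \<alpha>" "(i, j') \<in> ?D \<alpha>" "j < j'" for i j j'
      proof (cases "(i, j') \<in> diagram \<delta>")
        case True
        then have "(i, j) \<in> diagram \<delta>" using that by (auto simp: diagram_iff)
        then show ?thesis using True that tableauxD(2)[OF T(1), of i j j'] V1 by auto
      next
        case False
        then have "V (i, j') = k" using V2 that by auto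
        moreover have "V (i, j) \<le> k"
          using that V1[of "(i, j)"] V2[of "(i, j)"] ent[OF TB, of "(i, j)"]
          by (cases "(i, j) \<in> diagram \<delta>") auto
        ultimately show ?thesis by simp
      qed
      moreover have "V (i, j) < V (i', j)"
        if "j \<in> J" "(i, j) \<in> ?D \<alpha>" "(i', j) \<in> ?D \<alpha>" "i < i'" for i i' j
      proof -
        \<comment> \<open>The strip condition puts the lower of two cells in a column from
          \<open>J\<close> inside \<open>\<delta>\<close>, where entries are below \<open>k\<close>;
          the column stays strict even when the upper cell receives \<open>k\<close>.\<close>
        have ij: "(i, j) \<in> ?D \<delta>" using that s by (auto simp: strip_step_def)
        show ?thesis
        proof (cases "(i', j) \<in> diagram \<delta>")
          case True
          then show ?thesis using ij that tableauxD(3)[OF T(1), of j i i'] V1 by auto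
        next
          case False
          then have "V (i', j) = k" using V2 that by auto
          then show ?thesis using V1[OF ij] ent[OF TB ij] by simp
        qed
      qed
      ultimately have "V \<in> tableaux J (?D \<alpha>)" by (intro tableauxI)
      with w show "V \<in> ?A" by simp
    next
      fix V assume "V \<in> ?A"
      then have V: "V \<in> tableaux J (?D \<alpha>)" and w: "weight (?D \<alpha>) V = m + Poly_Mapping.single k n"
        by auto
      have le: "V c \<le> k" if "c \<in> ?D \<alpha>" for c
      proof -
        have "V c \<in> Poly_Mapping.keys (m + Poly_Mapping.single k n)"
          using that keys_weight[OF fin(1)[of \<alpha>], of V] w by auto
        then have "V c \<in> Poly_Mapping.keys m \<union> Poly_Mapping.keys (Poly_Mapping.single k n)"
          using Poly_Mapping.keys_add[of m "Poly_Mapping.single k n"] by blast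
        then show ?thesis using less[of "V c"] by (auto split: if_splits)
      qed
      have row: "V (i, j) \<le> V (i, j')"
        if "(i, j) \<in> ?D \<alpha>" "(i, j') \<in> ?D \<alpha>" "j < j'" for i j j'
        using tableauxD(2)[OF V] that by blast
      have col: "V (i, j) < V (i', j)"
        if "(i, j) \<in> ?D \<alpha>" "(i', j) \<in> ?D \<alpha>" "i < i'" "j \<in> J" for i i' j
        using tableauxD(3)[OF V] that by blast
      \<comment> \<open>The inner shape to be recovered: the cells with entries below
        \<open>k\<close>, together with the cells of \<open>\<beta>\<close>, which carry no
        entries.\<close>
      define X where "X = diagram \<beta> \<union> {c \<in> ?D \<alpha>. V c < k}"
      have "\<exists>\<delta>. diagram \<delta> = X"
      proof -
        have "finite X" by (simp add: X_def)
        moreover have "(i, j') \<in> X" if "(i, j) \<in> X" "j' < j" for i j j'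
        proof -
          have "(i, j) \<in> diagram \<beta> \<Longrightarrow> (i, j') \<in> diagram \<beta>"
            and "(i, j) \<in> diagram \<alpha> \<Longrightarrow> (i, j') \<in> diagram \<alpha>"
            using that by (auto simp: diagram_iff)
          moreover have "V (i, j') < k" if "(i, j') \<in> ?D \<alpha>" "(i, j) \<in> ?D \<alpha>" "V (i, j) < k"
            using row[OF that(1,2) \<open>j' < j\<close>] that by linarith
          ultimately show ?thesis using that unfolding X_def by blast
        qed
        moreover have "(i', 0) \<in> X" if "(i, 0) \<in> X" "i' < i" for i i'
        proof -
          have "(i, 0) \<in> diagram \<beta> \<Longrightarrow> (i', 0) \<in> diagram \<beta>"
            and "(i, 0) \<in> diagram \<alpha> \<Longrightarrow> (i', 0) \<in> diagram \<alpha>"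
            using that by (auto simp: diagram_col0)
          moreover have "V (i', 0) < k" if "(i', 0) \<in> ?D \<alpha>" "(i, 0) \<in> ?D \<alpha>" "V (i, 0) < k"
            using col[OF that(1,2) \<open>i' < i\<close> J] that by linarith
          ultimately show ?thesis using that unfolding X_def by blast
        qed
        ultimately show ?thesis using ex_diagram[of X] by blast
      qed
      then obtain \<delta> where \<delta>: "diagram \<delta> = X" ..
      have s: "diagram \<beta> \<subseteq> diagram \<delta>" "diagram \<delta> \<subseteq> diagram \<alpha>"
        using sub by (auto simp: \<delta> X_def)
      have k: "V c = k" if "c \<in> diagram \<alpha> - diagram \<delta>" for c
        using that le[of c] unfolding \<delta> X_def by force
      have lt: "V c < k" if "c \<in> ?D \<delta>" for c
        using that unfolding \<delta> X_def by auto
      have eq: "m + Poly_Mapping.single k n =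
          weight (?D \<delta>) V + Poly_Mapping.single k (card (diagram \<alpha> - diagram \<delta>))"
        using wt[OF s k] w by simp
      \<comment> \<open>As \<open>k\<close> occurs in neither \<open>m\<close> nor the inner weight,
        the exponent of \<open>k\<close> gives the size of the strip, and cancelling it gives the
        inner weight.\<close>
      have "k \<notin> Poly_Mapping.keys m" "k \<notin> Poly_Mapping.keys (weight (?D \<delta>) V)"
        using less lt by (auto simp: keys_weight)
      then have n: "card (diagram \<alpha> - diagram \<delta>) = n"
        using arg_cong[OF eq, of "\<lambda>p. Poly_Mapping.lookup p k"]
        by (simp add: lookup_add in_keys_iff)
      with eq have m: "weight (?D \<delta>) V = m" by simp
      have "strip_step J n \<delta> \<alpha>"
      proof -
        have "csize \<alpha> = csize \<delta> + n"
          using card_diff[OF s(2)] n card_mono[OF fin(2) s(2)] by (simp add: card_diagram)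
        moreover have "(i, j) \<in> diagram \<delta>"
          if "j \<in> J" "i < i'" "(i', j) \<in> diagram \<alpha>" for i i' j
        \<comment> \<open>Otherwise the lower cell would carry \<open>k\<close>, and strictness
          would force a larger entry above it. Closedness of \<open>\<beta>\<close> and
          \<open>\<alpha>\<close> ensures that both cells lie in the skew shape.\<close>
        proof (rule ccontr)
          assume n: "(i, j) \<notin> diagram \<delta>"
          then have ij: "(i, j) \<notin> diagram \<beta>" using s by auto
          then have i'j: "(i', j) \<in> ?D \<alpha>" using \<beta> that unfolding columns_closed_def by blast
          have "(i, j) \<in> diagram \<alpha>" using \<alpha> that unfolding columns_closed_def by blast
          with ij n have "(i, j) \<in> ?D \<alpha>" "(i, j) \<in> diagram \<alpha> - diagram \<delta>" by auto
          then have "V (i, j) < V (i', j)" "V (i, j) = k"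
            using col[of i j i'] i'j that k by auto
          with le[OF i'j] show False by simp
        qed
        ultimately show ?thesis using s by (simp add: strip_step_def)
      qed
      moreover have "restrict V (?D \<delta>) \<in> tableaux J (?D \<delta>)"
        by (rule tableauxI) (use row col s in \<open>auto simp: subset_iff\<close>)
      moreover have "weight (?D \<delta>) (restrict V (?D \<delta>)) = m"
        using weight_cong[of "?D \<delta>" "restrict V (?D \<delta>)" V] m by simp
      moreover have "f (\<delta>, restrict V (?D \<delta>)) c = V c" for c
        using k[of c] tableauxD(1)[OF V, of c] s by (auto simp: f_def)
      then have "f (\<delta>, restrict V (?D \<delta>)) = V" by auto
      ultimately show "V \<in> f ` Sigma ?I ?B"
        using s by (intro image_eqI[of _ _ "(\<delta>, restrict V (?D \<delta>))"] SigmaI) simp_all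
    qed
  qed
  then have "card ?A = card (Sigma ?I ?B)" by (rule bij_betw_same_card[symmetric])
  also have "\<dots> = (\<Sum>\<delta>\<in>?I. card (?B \<delta>))"
  proof (rule card_SigmaI)
    show "finite ?I" using finite_strip_step[of J n \<alpha>] by auto
    show "\<forall>\<delta>\<in>?I. finite (?B \<delta>)"
    proof
      fix \<delta>
      show "finite (?B \<delta>)"
        by (rule finite_subset[OF _ finite_fillings_weight[of "?D \<delta>" m]])
           (auto simp: tableaux_def)
    qed
  qed
  finally show ?thesis .
qed


section \<open>Coefficients of quasisymmetric generating functions\<close>

text \<open>The positive exponents of a monomial, read in increasing order of the variables. The
  coefficient of a quasisymmetric function at \<open>m\<close> depends only on this list.\<close>

definition nonzero_values :: "(nat \<Rightarrow>\<^sub>0 nat) \<Rightarrow> nat list" where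
  "nonzero_values m = map (Poly_Mapping.lookup m) (sorted_list_of_set (Poly_Mapping.keys m))"

lemma nonzero_values_0 [simp]: "nonzero_values 0 = []"
  by (simp add: nonzero_values_def)

lemma nonzero_values_pos: "x \<in> set (nonzero_values m) \<Longrightarrow> 0 < x"
  by (auto simp: nonzero_values_def in_keys_iff)

lemma parts_nonzero_values: "parts (Composition (nonzero_values m)) = nonzero_values m"
  by (rule parts_Composition) (rule nonzero_values_pos)

lemma sorted_list_of_set_insert_max:
  assumes "finite A" "\<And>x. x \<in> A \<Longrightarrow> x < k"
  shows "sorted_list_of_set (insert k A) = sorted_list_of_set A @ [k :: 'a :: linorder]"
proof (rule sorted_distinct_set_unique)
  show "sorted (sorted_list_of_set A @ [k])"
    using assms by (auto simp: sorted_append less_imp_le)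
  show "distinct (sorted_list_of_set A @ [k])"
    using assms by auto
qed (use assms in \<open>simp_all del: sorted_list_of_set_insert_remove\<close>)

lemma nonzero_values_add_max:
  assumes "0 < n" and less: "\<And>x. x \<in> Poly_Mapping.keys m \<Longrightarrow> x < k"
  shows "nonzero_values (m + Poly_Mapping.single k n) = nonzero_values m @ [n]"
proof -
  have k: "Poly_Mapping.lookup m k = 0"
    using less by (auto simp: in_keys_iff)
  have "Poly_Mapping.keys (m + Poly_Mapping.single k n) = insert k (Poly_Mapping.keys m)"
    using assms(1) by (auto simp: in_keys_iff lookup_add lookup_single when_def split: if_splits)
  moreover have "Poly_Mapping.lookup (m + Poly_Mapping.single k n) x = Poly_Mapping.lookup m x"
    if "x \<in> Poly_Mapping.keys m" for x
    using less[OF that] by (simp add: lookup_add lookup_single)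
  moreover have "Poly_Mapping.lookup (m + Poly_Mapping.single k n) k = n"
    by (simp add: lookup_add k)
  ultimately show ?thesis
    using sorted_list_of_set_insert_max[OF finite_keys less, of m]
    by (simp add: nonzero_values_def)
qed

text \<open>Exponent vectors are built by adjoining variables in increasing order. The step matches
  the removal of the largest entry of a tableau.\<close>

lemma exponent_max_induct [case_names zero add]:
  fixes m :: "nat \<Rightarrow>\<^sub>0 nat"
  assumes zero: "P 0"
    and add: "\<And>m k n. 0 < n \<Longrightarrow> (\<And>x. x \<in> Poly_Mapping.keys m \<Longrightarrow> x < k) \<Longrightarrow> P m \<Longrightarrow>
      P (m + Poly_Mapping.single k n)"
  shows "P m"
proof (induction "card (Poly_Mapping.keys m)" arbitrary: m)
  case 0
  then show ?case using zero by simp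
next
  case (Suc c)
  define k where "k = Max (Poly_Mapping.keys m)"
  define m' where "m' = Poly_Mapping.update k 0 m"
  have ne: "Poly_Mapping.keys m \<noteq> {}" using Suc.hyps(2) by (metis card.empty nat.distinct(1))
  then have k: "k \<in> Poly_Mapping.keys m" unfolding k_def by (intro Max_in) simp_all
  have keys: "Poly_Mapping.keys m' = Poly_Mapping.keys m - {k}"
    by (auto simp: m'_def in_keys_iff lookup_update split: if_splits)
  have m: "m = m' + Poly_Mapping.single k (Poly_Mapping.lookup m k)"
    by (rule poly_mapping_eqI) (simp add: m'_def lookup_add lookup_update lookup_single when_def)
  have "P (m' + Poly_Mapping.single k (Poly_Mapping.lookup m k))"
  proof (rule add)
    show "0 < Poly_Mapping.lookup m k" using k by (simp add: in_keys_iff)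
    show "x < k" if "x \<in> Poly_Mapping.keys m'" for x
    proof -
      have "x \<le> k" "x \<noteq> k" using that keys unfolding k_def by (auto intro: Max_ge)
      then show ?thesis by simp
    qed
    show "P m'" using Suc.hyps k keys by simp
  qed
  with m show ?case by simp
qed

text \<open>The indices of a monomial of \<open>M\<^sub>\<gamma>\<close> must be exactly the
  variables occurring in \<open>m\<close>, in increasing order, so at most one index list
  contributes.\<close>

lemma monomial_qsym_eq:
  "monomial_qsym \<gamma> m = (if parts \<gamma> = nonzero_values m then 1 else (0 :: 'a::comm_ring_1))"
proof -
  let ?is = "sorted_list_of_set (Poly_Mapping.keys m)"
  let ?S = "{is \<in> {is. length is = clength \<gamma> \<and> sorted_wrt (<) is}. mon_vec \<gamma> is = m}"
  have 1: "is = ?is \<and> parts \<gamma> = nonzero_values m"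
    if "length is = clength \<gamma>" "sorted_wrt (<) is" "mon_vec \<gamma> is = m" for "is"
  proof -
    have d: "distinct is" "sorted is" using that by (simp_all add: strict_sorted_iff)
    then have "Poly_Mapping.keys m = set is" using keys_mon_vec that by blast
    then have i: "is = ?is" using d by (intro sorted_distinct_set_unique) auto
    have "parts \<gamma> = map (Poly_Mapping.lookup m) is"
      using lookup_mon_vec[OF that(1) d(1)] that
      by (intro nth_equalityI) (simp_all add: clength_def cpart_def)
    with i show ?thesis by (simp add: nonzero_values_def)
  qed
  have 2: "?is \<in> ?S" if p: "parts \<gamma> = nonzero_values m"
  proof -
    have len: "length ?is = clength \<gamma>" using p by (simp add: clength_def nonzero_values_def)
    have "Poly_Mapping.lookup (mon_vec \<gamma> ?is) x = Poly_Mapping.lookup m x" for x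
    proof (cases "x \<in> Poly_Mapping.keys m")
      case True
      then obtain j where j: "j < clength \<gamma>" "x = ?is ! j"
        by (metis finite_keys in_set_conv_nth len set_sorted_list_of_set)
      then have "Poly_Mapping.lookup (mon_vec \<gamma> ?is) x = cpart \<gamma> j"
        using lookup_mon_vec[OF len] by simp
      also have "\<dots> = Poly_Mapping.lookup m x"
        using j len p by (simp add: cpart_def nonzero_values_def)
      finally show ?thesis .
    next
      case False
      then have "x \<notin> Poly_Mapping.keys (mon_vec \<gamma> ?is)"
        using keys_mon_vec[OF len] by simp
      with False show ?thesis by (simp add: in_keys_iff)
    qed
    then have "mon_vec \<gamma> ?is = m" by (rule poly_mapping_eqI)
    with len show ?thesis by simp
  qed
  have "?S = (if parts \<gamma> = nonzero_values m then {?is} else {})"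
  proof (cases "parts \<gamma> = nonzero_values m")
    case True
    with 2 have "?is \<in> ?S" by blast
    with True 1 show ?thesis by auto
  qed (use 1 in auto)
  then show ?thesis by (simp add: monomial_qsym_def gen_fun_def)
qed

text \<open>Iterated removal of the largest entry. The strip sizes come out from the largest
  variable down, hence the reversal.\<close>

lemma card_tableaux_weight:
  assumes "0 \<in> J" "columns_closed J \<alpha>" "columns_closed J \<beta>" "diagram \<beta> \<subseteq> diagram \<alpha>"
  shows "card {T \<in> tableaux J (diagram \<alpha> - diagram \<beta>). weight (diagram \<alpha> - diagram \<beta>) T = m} =
    chains J \<beta> (rev (nonzero_values m)) \<alpha>"
  using assms(2,4)
proof (induction m arbitrary: \<alpha> rule: exponent_max_induct)
  case zero
  let ?D = "diagram \<alpha> - diagram \<beta>"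
  \<comment> \<open>Each cell contributes to the weight, so weight 0 means that there are no cells;
    the only filling is then undefined everywhere.\<close>
  have *: "weight ?D T = 0 \<longleftrightarrow> ?D = {}" for T
    using keys_weight[of ?D T] by (metis finite_Diff finite_diagram image_is_empty keys_eq_empty)
  show ?case
  proof (cases "\<alpha> = \<beta>")
    case True
    then have "{T \<in> tableaux J ?D. weight ?D T = 0} = {\<lambda>_. undefined}"
      using * by (auto simp: tableaux_def)
    with True show ?thesis by simp
  next
    case False
    then have "?D \<noteq> {}" using zero diagram_inject by blast
    with * False show ?thesis by simp
  qed
next
  case (add m k n)
  let ?B = "\<lambda>\<delta>. card {T \<in> tableaux J (diagram \<delta> - diagram \<beta>).
    weight (diagram \<delta> - diagram \<beta>) T = m}"
  have "card {T \<in> tableaux J (diagram \<alpha> - diagram \<beta>).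
        weight (diagram \<alpha> - diagram \<beta>) T = m + Poly_Mapping.single k n} =
      (\<Sum>\<delta> | strip_step J n \<delta> \<alpha> \<and> diagram \<beta> \<subseteq> diagram \<delta>. ?B \<delta>)"
    using assms add by (intro card_tableaux_peel) auto
  also have "\<dots> = (\<Sum>\<delta> | strip_step J n \<delta> \<alpha> \<and> diagram \<beta> \<subseteq> diagram \<delta>.
      chains J \<beta> (rev (nonzero_values m)) \<delta>)"
    using add.IH add.prems(1) strip_step_closed by (intro sum.cong) auto
  also have "\<dots> = (\<Sum>\<delta> | strip_step J n \<delta> \<alpha>. chains J \<beta> (rev (nonzero_values m)) \<delta>)"
  proof (intro sum.mono_neutral_left ballI)
    fix \<delta> assume "\<delta> \<in> {\<delta>. strip_step J n \<delta> \<alpha>} - {\<delta>. strip_step J n \<delta> \<alpha> \<and> diagram \<beta> \<subseteq> diagram \<delta>}"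
    then show "chains J \<beta> (rev (nonzero_values m)) \<delta> = 0"
      using chains_nonzero[of J \<beta> _ \<delta>] by blast
  qed (auto simp: finite_strip_step)
  also have "\<dots> = chains J \<beta> (rev (nonzero_values (m + Poly_Mapping.single k n))) \<alpha>"
    using add.hyps by (simp add: nonzero_values_add_max)
  finally show ?case .
qed

section \<open>Skew Schur and dual immaculate coefficients as chain counts\<close>

lemma skew_schur_eq:
  assumes "is_partition \<alpha>" "is_partition \<beta>" "\<beta> \<subseteq>\<^sub>c \<alpha>"
  shows "skew_schur \<alpha> \<beta> m = (of_nat (chains UNIV \<beta> (rev (nonzero_values m)) \<alpha>) :: 'a::comm_ring_1)"
  using assms card_tableaux_weight[of UNIV \<alpha> \<beta> m]
  by (simp add: skew_schur_def gen_fun_def ssyt_tableaux columns_closed_UNIV diagram_subset_iff)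

text \<open>The number of immaculate tableaux of shape \<open>\<alpha>\<close> and content
  \<open>\<gamma>\<close>, an analogue of the Kostka numbers. The content is reversed because
  \<open>chains\<close> lists the last strip first.\<close>

definition immaculate_kostka :: "composition \<Rightarrow> composition \<Rightarrow> nat" where
  "immaculate_kostka \<gamma> \<alpha> = chains {0} 0 (rev (parts \<gamma>)) \<alpha>"

lemma dual_immaculate_eq:
  "dual_immaculate \<alpha> m =
    (of_nat (immaculate_kostka (Composition (nonzero_values m)) \<alpha>) :: 'a::comm_ring_1)"
  using card_tableaux_weight[of "{0}" \<alpha> 0 m]
  by (simp add: dual_immaculate_def gen_fun_def immaculate_tableaux_tableaux columns_closed_0
      immaculate_kostka_def parts_nonzero_values)

lemma immaculate_kostka_csize: "immaculate_kostka \<gamma> \<alpha> \<noteq> 0 \<Longrightarrow> csize \<gamma> = csize \<alpha>"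
  unfolding immaculate_kostka_def by (drule chains_nonzero) (simp add: csize_def)

lemma lookup_sum_single:
  assumes "finite A"
  shows "Poly_Mapping.lookup (\<Sum>a\<in>A. Poly_Mapping.single a (u a)) x = (if x \<in> A then u x else 0)"
proof -
  have "Poly_Mapping.lookup (\<Sum>a\<in>A. Poly_Mapping.single a (u a)) x =
      (\<Sum>a\<in>A. if a = x then u a else 0)"
    unfolding lookup_sum by (intro sum.cong) (simp_all add: lookup_single when_def)
  then show ?thesis using assms by simp
qed

text \<open>Only the finitely many contents of size \<open>csize \<alpha>\<close> occur, so the dual
  immaculate function is a finite combination of monomial functions. This makes
  \<open>M_coords\<close>, and with it the pairing, computable by tableau counts.\<close>

lemma M_coords_dual_immaculate:
  "Poly_Mapping.lookup (M_coords (dual_immaculate \<alpha>) :: composition \<Rightarrow>\<^sub>0 'a::comm_ring_1) \<gamma> =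
    of_nat (immaculate_kostka \<gamma> \<alpha>)"
proof -
  define c :: "composition \<Rightarrow>\<^sub>0 'a" where
    "c = (\<Sum>\<gamma> | csize \<gamma> = csize \<alpha>. Poly_Mapping.single \<gamma> (of_nat (immaculate_kostka \<gamma> \<alpha>)))"
  have c: "Poly_Mapping.lookup c \<gamma> = of_nat (immaculate_kostka \<gamma> \<alpha>)" for \<gamma>
    using immaculate_kostka_csize[of \<gamma> \<alpha>]
    by (cases "immaculate_kostka \<gamma> \<alpha> = 0") (simp_all add: c_def lookup_sum_single finite_csize)
  have "dual_immaculate \<alpha> m = qsym_comb c m" for m
  proof -
    have "parts \<beta> = nonzero_values m \<longleftrightarrow> \<beta> = Composition (nonzero_values m)" for \<beta>
      by (metis parts_inverse parts_nonzero_values)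
    then have "qsym_comb c m = (\<Sum>\<beta>\<in>Poly_Mapping.keys c.
        if \<beta> = Composition (nonzero_values m) then Poly_Mapping.lookup c \<beta> else 0)"
      unfolding qsym_comb_def by (intro sum.cong) (simp_all add: monomial_qsym_eq)
    also have "\<dots> = Poly_Mapping.lookup c (Composition (nonzero_values m))"
      by (simp add: in_keys_iff)
    also have "\<dots> = dual_immaculate \<alpha> m"
      by (simp add: c dual_immaculate_eq)
    finally show ?thesis by simp
  qed
  then have "dual_immaculate \<alpha> = qsym_comb c" by auto
  then show ?thesis by (simp add: M_coords_qsym_comb c)
qed

lemma pairing_superset:
  assumes "finite A" "Poly_Mapping.keys H \<subseteq> A"
  shows "pairing H F = (\<Sum>\<gamma>\<in>A. Poly_Mapping.lookup H \<gamma> * Poly_Mapping.lookup (M_coords F) \<gamma>)"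
  unfolding pairing_def using assms by (intro sum.mono_neutral_left) (auto simp: in_keys_iff)

lemma pairing_dual_immaculate:
  assumes "finite A" "Poly_Mapping.keys H \<subseteq> A"
  shows "pairing H (dual_immaculate \<alpha>) =
    (\<Sum>\<gamma>\<in>A. Poly_Mapping.lookup H \<gamma> * of_nat (immaculate_kostka \<gamma> \<alpha>))"
  by (simp add: pairing_superset[OF assms] M_coords_dual_immaculate)


section \<open>Triangularity and the immaculate basis\<close>

text \<open>In a chain of strips, the cells added in step \<open>i\<close> lie in the rows up to \<open>i\<close>.  Hence the
  sum of the row indices of the cells is at most that of the content, with equality only when
  step \<open>i\<close> fills exactly row \<open>i\<close>.\<close>

definition row_weight :: "nat list \<Rightarrow> nat" where
  "row_weight xs = (\<Sum>i<length xs. i * xs ! i)"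

lemma row_weight_snoc: "row_weight (xs @ [n]) = row_weight xs + length xs * n"
  by (simp add: row_weight_def nth_append)

lemma row_weight_diagram: "row_weight (parts \<alpha>) = (\<Sum>c\<in>diagram \<alpha>. fst c)"
proof -
  have "(\<Sum>c\<in>diagram \<alpha>. fst c) = (\<Sum>(i, j)\<in>diagram \<alpha>. i)"
    by (simp add: split_def)
  also have "\<dots> = (\<Sum>i<clength \<alpha>. \<Sum>j<cpart \<alpha> i. i)"
    unfolding diagram_Sigma by (subst sum.Sigma) simp_all
  also have "\<dots> = row_weight (parts \<alpha>)"
    by (simp add: row_weight_def clength_def cpart_def mult.commute)
  finally show ?thesis ..
qed

lemma strip_step_0_row_weight:
  assumes s: "strip_step {0} n \<delta> \<alpha>" and l: "clength \<delta> \<le> l"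
  shows "clength \<alpha> \<le> Suc l"
    and "row_weight (parts \<alpha>) \<le> row_weight (parts \<delta>) + l * n"
    and "row_weight (parts \<alpha>) = row_weight (parts \<delta>) + l * n \<Longrightarrow>
      c \<in> diagram \<alpha> - diagram \<delta> \<Longrightarrow> fst c = l"
proof -
  have sub: "diagram \<delta> \<subseteq> diagram \<alpha>" and size: "csize \<alpha> = csize \<delta> + n"
    using s by (auto simp: strip_step_def)
  show len: "clength \<alpha> \<le> Suc l"
  proof (rule ccontr)
    assume "\<not> clength \<alpha> \<le> Suc l"
    then have "(Suc l, 0) \<in> diagram \<alpha>" by (simp add: diagram_col0)
    \<comment> \<open>Two new rows would put two new cells into column 0, which the strip condition
      forbids.\<close>
    then have "(l, 0) \<in> diagram \<delta>" using s lessI unfolding strip_step_def by blast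
    with l show False by (simp add: diagram_col0)
  qed
  let ?E = "diagram \<alpha> - diagram \<delta>"
  have E: "finite ?E" "card ?E = n"
    using size sub by (simp_all add: finite_diagram card_Diff_subset card_diagram)
  have le: "fst c \<le> l" if "c \<in> ?E" for c
    using that len by (auto simp: diagram_def)
  have rw: "row_weight (parts \<alpha>) = row_weight (parts \<delta>) + (\<Sum>c\<in>?E. fst c)"
    unfolding row_weight_diagram using sum.subset_diff[OF sub finite_diagram] by (simp add: add.commute)
  have "(\<Sum>c\<in>?E. fst c) \<le> (\<Sum>c\<in>?E. l)" using le by (rule sum_mono)
  then show "row_weight (parts \<alpha>) \<le> row_weight (parts \<delta>) + l * n"
    using rw E by (simp add: mult.commute)
  assume eq: "row_weight (parts \<alpha>) = row_weight (parts \<delta>) + l * n" and c: "c \<in> ?E"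
  show "fst c = l"
  proof (rule ccontr)
    assume "fst c \<noteq> l"
    then have "fst c < l" using le[OF c] by simp
    then have "(\<Sum>c\<in>?E. fst c) < (\<Sum>c\<in>?E. l)"
      using E(1) le c by (intro sum_strict_mono_ex1) auto
    then show False using rw eq E by (simp add: mult.commute)
  qed
qed

lemma chains_0_row_weight:
  assumes "chains {0} 0 (rev xs) \<alpha> \<noteq> 0" "\<And>x. x \<in> set xs \<Longrightarrow> 0 < x"
  shows "clength \<alpha> \<le> length xs \<and> row_weight (parts \<alpha>) \<le> row_weight xs \<and>
    (row_weight (parts \<alpha>) = row_weight xs \<longrightarrow> parts \<alpha> = xs)"
  using assms
proof (induction xs arbitrary: \<alpha> rule: rev_induct)
  case Nil
  then show ?case by (auto simp: clength_def row_weight_def split: if_splits)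
next
  case (snoc n xs)
  obtain \<delta> where s: "strip_step {0} n \<delta> \<alpha>" and \<delta>: "chains {0} 0 (rev xs) \<delta> \<noteq> 0"
    using snoc.prems(1) unfolding rev_append rev.simps append_Nil append_Cons
    by (rule chains_Cons_nonzeroE)
  have IH: "clength \<delta> \<le> length xs" "row_weight (parts \<delta>) \<le> row_weight xs"
      "row_weight (parts \<delta>) = row_weight xs \<Longrightarrow> parts \<delta> = xs"
    using snoc.IH[OF \<delta>] snoc.prems(2) by auto
  note st = strip_step_0_row_weight[OF s IH(1)]
  have "parts \<alpha> = xs @ [n]" if eq: "row_weight (parts \<alpha>) = row_weight (xs @ [n])"
  proof -
    \<comment> \<open>Equality in the total forces equality in both bounds: the induction hypothesis
      identifies \<open>\<delta>\<close>, and the last strip, nonempty as \<open>0 < n\<close>, lies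
      entirely in the new top row.\<close>
    have "row_weight (parts \<delta>) = row_weight xs"
      using eq st(2) IH(2) by (simp add: row_weight_snoc)
    then have xs: "parts \<delta> = xs" and last: "c \<in> diagram \<alpha> - diagram \<delta> \<Longrightarrow> fst c = length xs" for c
      using IH(3) st(3) eq by (simp_all add: row_weight_snoc)
    have len\<delta>: "clength \<delta> = length xs" by (simp add: clength_def xs)
    have sub: "diagram \<delta> \<subseteq> diagram \<alpha>" and size: "csize \<alpha> = csize \<delta> + n"
      using s by (auto simp: strip_step_def)
    have "0 < n" using snoc.prems(2) by simp
    then have "diagram \<alpha> \<noteq> diagram \<delta>" using size card_diagram by (metis add_cancel_left_right less_numeral_extra(3))
    then obtain c where c: "c \<in> diagram \<alpha> - diagram \<delta>" using sub by blast
    then have "length xs < clength \<alpha>" using last[OF c] by (auto simp: diagram_def)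
    with st(1) have len: "clength \<alpha> = Suc (length xs)" by simp
    have eq: "cpart \<alpha> i = cpart \<delta> i" if i: "i < length xs" for i
    proof -
      have "(i, j) \<in> diagram \<alpha> \<longleftrightarrow> (i, j) \<in> diagram \<delta>" for j
        using last[of "(i, j)"] i sub by auto
      then have "j < cpart \<alpha> i \<longleftrightarrow> j < cpart \<delta> i" for j
        using i len len\<delta> by (simp add: diagram_iff)
      then show ?thesis by (metis nat_neq_iff)
    qed
    have "cpart \<alpha> (length xs) = n"
      using size eq by (simp add: csize_eq_sum len len\<delta>)
    then show ?thesis
      using eq len xs
      by (intro nth_equalityI) (auto simp: clength_def cpart_def nth_append less_Suc_eq)
  qed
  then show ?case using st(1,2) IH by (auto simp: row_weight_snoc)
qed

text \<open>Equality in the row weight bounds leaves a single predecessor, the composition without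
  its last part. The only chain therefore adds the rows one at a time.\<close>

lemma chains_0_self:
  assumes "\<And>x. x \<in> set xs \<Longrightarrow> 0 < x"
  shows "chains {0} 0 (rev xs) (Composition xs) = 1"
  using assms
proof (induction xs rule: rev_induct)
  case Nil
  then show ?case by (simp add: zero_composition_def)
next
  case (snoc n xs)
  let ?\<alpha> = "Composition (xs @ [n])" and ?\<delta> = "Composition xs"
  have p\<alpha>: "parts ?\<alpha> = xs @ [n]" and p\<delta>: "parts ?\<delta> = xs"
    using snoc.prems by (auto intro: parts_Composition)
  have \<delta>: "\<delta> = ?\<delta>" if "strip_step {0} n \<delta> ?\<alpha>" "chains {0} 0 (rev xs) \<delta> \<noteq> 0" for \<delta>
  proof -
    have c: "clength \<delta> \<le> length xs" "row_weight (parts \<delta>) \<le> row_weight xs"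
        "row_weight (parts \<delta>) = row_weight xs \<Longrightarrow> parts \<delta> = xs"
      using chains_0_row_weight[OF that(2)] snoc.prems by auto
    have "row_weight (parts \<delta>) = row_weight xs"
      using strip_step_0_row_weight(2)[OF that(1) c(1)] c(2) by (simp add: p\<alpha> row_weight_snoc)
    with c(3) p\<delta> show ?thesis by (metis parts_inverse)
  qed
  have s: "strip_step {0} n ?\<delta> ?\<alpha>"
  proof -
    have "?\<delta> \<subseteq>\<^sub>c ?\<alpha>"
      by (simp add: csubset_def clength_def cpart_def p\<alpha> p\<delta> nth_append)
    moreover have "clength ?\<alpha> = Suc (clength ?\<delta>)" by (simp add: clength_def p\<alpha> p\<delta>)
    ultimately show ?thesis
      by (auto simp: strip_step_def diagram_subset_iff diagram_col0 csize_def p\<alpha> p\<delta>)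
  qed
  have "chains {0} 0 (rev (xs @ [n])) ?\<alpha> = (\<Sum>\<delta> | strip_step {0} n \<delta> ?\<alpha>. chains {0} 0 (rev xs) \<delta>)"
    by simp
  also have "\<dots> = (\<Sum>\<delta>\<in>{?\<delta>}. chains {0} 0 (rev xs) \<delta>)"
    using \<delta> s finite_strip_step by (intro sum.mono_neutral_right) auto
  finally show ?case using snoc by simp
qed

section \<open>Inverting the unitriangular matrix of tableau counts\<close>

lemma immaculate_kostka_self: "immaculate_kostka \<alpha> \<alpha> = 1"
  using chains_0_self[of "parts \<alpha>"] parts_pos by (simp add: immaculate_kostka_def parts_inverse)

lemma immaculate_kostka_triangular:
  assumes "immaculate_kostka \<gamma> \<alpha> \<noteq> 0"
  shows "\<alpha> = \<gamma> \<or> row_weight (parts \<alpha>) < row_weight (parts \<gamma>)"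
  using chains_0_row_weight[of "parts \<gamma>" \<alpha>] assms parts_pos
  by (auto simp: immaculate_kostka_def parts_inject le_less)

text \<open>Back substitution, valid over any commutative ring because the diagonal entries are 1.
  The unit vector at \<open>\<beta>\<close> yields the entries
  \<open>immaculate_kostka \<beta> \<alpha>\<close>; those with
  \<open>\<alpha> \<noteq> \<beta>\<close> have smaller row weight and are cancelled by the
  solutions already found.\<close>

lemma immaculate_kostka_inverse:
  "\<exists>u :: composition \<Rightarrow> 'a::comm_ring_1. \<forall>\<alpha>. csize \<alpha> = d \<longrightarrow>
     (\<Sum>\<gamma> | csize \<gamma> = d. u \<gamma> * of_nat (immaculate_kostka \<gamma> \<alpha>)) = (if \<beta> = \<alpha> then 1 else 0)"
  if "csize \<beta> = d" for \<beta>
  using that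
proof (induction "row_weight (parts \<beta>)" arbitrary: \<beta> rule: less_induct)
  case less
  let ?K = "\<lambda>\<gamma> \<alpha>. of_nat (immaculate_kostka \<gamma> \<alpha>) :: 'a"
  let ?S = "{\<alpha>. csize \<alpha> = d \<and> row_weight (parts \<alpha>) < row_weight (parts \<beta>)}"
  have finS: "finite ?S" by (rule finite_subset[OF _ finite_csize[of d]]) auto
  have "\<forall>\<beta>'\<in>?S. \<exists>u :: composition \<Rightarrow> 'a. \<forall>\<alpha>. csize \<alpha> = d \<longrightarrow>
      (\<Sum>\<gamma> | csize \<gamma> = d. u \<gamma> * ?K \<gamma> \<alpha>) = (if \<beta>' = \<alpha> then 1 else 0)"
    using less.hyps by blast
  from bchoice[OF this] obtain u where u: "\<forall>\<beta>'\<in>?S. \<forall>\<alpha>. csize \<alpha> = d \<longrightarrow>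
      (\<Sum>\<gamma> | csize \<gamma> = d. u \<beta>' \<gamma> * ?K \<gamma> \<alpha>) = (if \<beta>' = \<alpha> then 1 else 0)" ..
  define v where "v \<gamma> = (if \<gamma> = \<beta> then 1 else 0) - (\<Sum>\<beta>'\<in>?S. ?K \<beta> \<beta>' * u \<beta>' \<gamma>)" for \<gamma>
  have "(\<Sum>\<gamma> | csize \<gamma> = d. v \<gamma> * ?K \<gamma> \<alpha>) = (if \<beta> = \<alpha> then 1 else 0)" if \<alpha>: "csize \<alpha> = d" for \<alpha>
  proof -
    have "(\<Sum>\<gamma> | csize \<gamma> = d. v \<gamma> * ?K \<gamma> \<alpha>) =
        (\<Sum>\<gamma> | csize \<gamma> = d. (if \<gamma> = \<beta> then ?K \<gamma> \<alpha> else 0)) -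
        (\<Sum>\<gamma> | csize \<gamma> = d. \<Sum>\<beta>'\<in>?S. ?K \<beta> \<beta>' * (u \<beta>' \<gamma> * ?K \<gamma> \<alpha>))"
      unfolding sum_subtractf[symmetric]
      by (intro sum.cong) (auto simp: v_def left_diff_distrib sum_distrib_right mult.assoc)
    also have "(\<Sum>\<gamma> | csize \<gamma> = d. \<Sum>\<beta>'\<in>?S. ?K \<beta> \<beta>' * (u \<beta>' \<gamma> * ?K \<gamma> \<alpha>)) =
        (\<Sum>\<beta>'\<in>?S. ?K \<beta> \<beta>' * (\<Sum>\<gamma> | csize \<gamma> = d. u \<beta>' \<gamma> * ?K \<gamma> \<alpha>))"
      by (subst sum.swap) (simp add: sum_distrib_left)
    also have "\<dots> = (\<Sum>\<beta>'\<in>?S. if \<beta>' = \<alpha> then ?K \<beta> \<beta>' else 0)"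
      using u \<alpha> by (intro sum.cong) auto
    also have "\<dots> = (if \<alpha> \<in> ?S then ?K \<beta> \<alpha> else 0)"
      using finS by simp
    also have "(\<Sum>\<gamma> | csize \<gamma> = d. (if \<gamma> = \<beta> then ?K \<gamma> \<alpha> else 0)) = ?K \<beta> \<alpha>"
      using less.prems finite_csize by simp
    also have "?K \<beta> \<alpha> - (if \<alpha> \<in> ?S then ?K \<beta> \<alpha> else 0) = (if \<beta> = \<alpha> then 1 else 0)"
    proof (cases "immaculate_kostka \<beta> \<alpha> = 0")
      case True
      then have "\<beta> \<noteq> \<alpha>" using immaculate_kostka_self by (metis zero_neq_one)
      with True show ?thesis by simp
    next
      case False
      then show ?thesis
        using immaculate_kostka_triangular[OF False] \<alpha> by (auto simp: immaculate_kostka_self)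
    qed
    finally show ?thesis .
  qed
  then show ?case by blast
qed

text \<open>Among the compositions where \<open>H\<close> and \<open>H'\<close> differ, take
  \<open>\<alpha>\<close> of maximal row weight. By triangularity, pairing the difference with
  \<open>dual_immaculate \<alpha>\<close> leaves only the coefficient at
  \<open>\<alpha>\<close>.\<close>

lemma pairing_dual_immaculate_inject:
  fixes H H' :: "'a::comm_ring_1 nsym"
  assumes eq: "\<And>\<alpha>. pairing H (dual_immaculate \<alpha>) = pairing H' (dual_immaculate \<alpha>)"
  shows "H = H'"
proof (rule ccontr)
  assume "H \<noteq> H'"
  define A where "A = Poly_Mapping.keys H \<union> Poly_Mapping.keys H'"
  define u where "u \<gamma> = Poly_Mapping.lookup H \<gamma> - Poly_Mapping.lookup H' \<gamma>" for \<gamma>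
  have A: "finite A" "Poly_Mapping.keys H \<subseteq> A" "Poly_Mapping.keys H' \<subseteq> A" by (auto simp: A_def)
  define S where "S = {\<gamma> \<in> A. u \<gamma> \<noteq> 0}"
  have S: "finite S" using A by (simp add: S_def)
  obtain \<gamma> where "Poly_Mapping.lookup H \<gamma> \<noteq> Poly_Mapping.lookup H' \<gamma>"
    using \<open>H \<noteq> H'\<close> by (meson poly_mapping_eqI)
  then have "\<gamma> \<in> S" by (auto simp: S_def u_def A_def in_keys_iff)
  let ?R = "(\<lambda>\<gamma>. row_weight (parts \<gamma>)) ` S"
  have "Max ?R \<in> ?R" using S \<open>\<gamma> \<in> S\<close> by (intro Max_in) auto
  then obtain \<alpha> where \<alpha>: "\<alpha> \<in> S" "row_weight (parts \<alpha>) = Max ?R" by auto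
  have le: "row_weight (parts \<gamma>) \<le> row_weight (parts \<alpha>)" if "\<gamma> \<in> S" for \<gamma>
    unfolding \<alpha>(2) using S that by (intro Max_ge) auto
  have z: "u \<gamma> * of_nat (immaculate_kostka \<gamma> \<alpha>) = 0" if "\<gamma> \<in> A - {\<alpha>}" for \<gamma>
  proof (rule ccontr)
    assume *: "u \<gamma> * of_nat (immaculate_kostka \<gamma> \<alpha>) \<noteq> 0"
    then have "immaculate_kostka \<gamma> \<alpha> \<noteq> 0" by (metis mult_zero_right of_nat_0)
    moreover have "\<gamma> \<in> S" using * that by (auto simp: S_def)
    ultimately have "\<gamma> \<in> S" "immaculate_kostka \<gamma> \<alpha> \<noteq> 0" by auto
    with le[of \<gamma>] immaculate_kostka_triangular[of \<gamma> \<alpha>] that show False by auto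
  qed
  have "0 = (\<Sum>\<gamma>\<in>A. u \<gamma> * of_nat (immaculate_kostka \<gamma> \<alpha>))"
    using eq[of \<alpha>] A
    by (simp add: pairing_dual_immaculate[of A] u_def left_diff_distrib sum_subtractf)
  also have "\<dots> = u \<alpha>"
    using \<alpha>(1) A(1) z by (subst sum.remove[of _ \<alpha>]) (auto simp: S_def immaculate_kostka_self)
  finally show False using \<alpha>(1) by (simp add: S_def)
qed

text \<open>Existence and uniqueness of the dual element justify the definite description in
  \<open>immaculate\<close>.\<close>

lemma pairing_immaculate:
  "pairing (immaculate \<beta>) (dual_immaculate \<alpha>) = (if \<beta> = \<alpha> then 1 else (0 :: 'a::comm_ring_1))"
proof -
  have "\<exists>!H :: 'a nsym. \<forall>\<alpha>. pairing H (dual_immaculate \<alpha>) = (if \<beta> = \<alpha> then 1 else 0)"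
  proof (rule ex_ex1I)
    let ?d = "csize \<beta>"
    obtain u :: "composition \<Rightarrow> 'a" where u: "\<And>\<alpha>. csize \<alpha> = ?d \<Longrightarrow>
        (\<Sum>\<gamma> | csize \<gamma> = ?d. u \<gamma> * of_nat (immaculate_kostka \<gamma> \<alpha>)) = (if \<beta> = \<alpha> then 1 else 0)"
      using immaculate_kostka_inverse[OF refl, of \<beta>] by blast
    define H where "H = (\<Sum>\<gamma> | csize \<gamma> = ?d. Poly_Mapping.single \<gamma> (u \<gamma>))"
    have H: "Poly_Mapping.lookup H \<gamma> = (if csize \<gamma> = ?d then u \<gamma> else 0)" for \<gamma>
      by (simp add: H_def lookup_sum_single finite_csize)
    have "pairing H (dual_immaculate \<alpha>) = (if \<beta> = \<alpha> then 1 else 0)" for \<alpha>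
    proof -
      have "pairing H (dual_immaculate \<alpha>) =
          (\<Sum>\<gamma> | csize \<gamma> = ?d. Poly_Mapping.lookup H \<gamma> * of_nat (immaculate_kostka \<gamma> \<alpha>))"
        by (rule pairing_dual_immaculate) (auto simp: finite_csize in_keys_iff H split: if_splits)
      also have "\<dots> = (\<Sum>\<gamma> | csize \<gamma> = ?d. u \<gamma> * of_nat (immaculate_kostka \<gamma> \<alpha>))"
        by (simp add: H)
      also have "\<dots> = (if \<beta> = \<alpha> then 1 else 0)"
      proof (cases "csize \<alpha> = ?d")
        case False
        then have "immaculate_kostka \<gamma> \<alpha> = 0" if "csize \<gamma> = ?d" for \<gamma>
          using immaculate_kostka_csize[of \<gamma> \<alpha>] that by auto
        with False show ?thesis by auto
      qed (rule u)
      finally show ?thesis .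
    qed
    then show "\<exists>H :: 'a nsym. \<forall>\<alpha>. pairing H (dual_immaculate \<alpha>) = (if \<beta> = \<alpha> then 1 else 0)"
      by blast
  qed (rule pairing_dual_immaculate_inject, simp)
  from theI'[OF this] show ?thesis by (simp add: immaculate_def)
qed


section \<open>The Pieri rule\<close>

text \<open>Appending \<open>\<kappa>\<close> is injective on compositions, so right multiplication
  by \<open>h \<kappa>\<close> merely relabels basis elements.\<close>

lemma lookup_mult_h: "Poly_Mapping.lookup (H * h \<kappa>) (\<gamma> + \<kappa>) = Poly_Mapping.lookup H \<gamma>"
  and keys_mult_h: "Poly_Mapping.keys (H * h \<kappa>) \<subseteq> (\<lambda>\<gamma>. \<gamma> + \<kappa>) ` Poly_Mapping.keys H"
proof -
  have inj: "\<gamma> + \<kappa> = \<gamma>' + \<kappa> \<longleftrightarrow> \<gamma> = \<gamma>'" for \<gamma> \<gamma>' :: composition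
    by (simp flip: parts_inject)
  have H: "H = (\<Sum>\<gamma>\<in>Poly_Mapping.keys H. Poly_Mapping.single \<gamma> (Poly_Mapping.lookup H \<gamma>))"
    by (rule poly_mapping_eqI) (simp add: lookup_sum_single in_keys_iff)
  have "H * h \<kappa> = (\<Sum>\<gamma>\<in>Poly_Mapping.keys H. Poly_Mapping.single (\<gamma> + \<kappa>) (Poly_Mapping.lookup H \<gamma>))"
    by (subst H) (simp add: sum_distrib_right h_def mult_single)
  then have *: "Poly_Mapping.lookup (H * h \<kappa>) \<epsilon> =
      (\<Sum>\<gamma>\<in>Poly_Mapping.keys H. if \<gamma> + \<kappa> = \<epsilon> then Poly_Mapping.lookup H \<gamma> else 0)" for \<epsilon>
    by (auto simp: lookup_sum lookup_single when_def intro!: sum.cong)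
  show "Poly_Mapping.lookup (H * h \<kappa>) (\<gamma> + \<kappa>) = Poly_Mapping.lookup H \<gamma>"
    by (simp add: * inj in_keys_iff)
  show "Poly_Mapping.keys (H * h \<kappa>) \<subseteq> (\<lambda>\<gamma>. \<gamma> + \<kappa>) ` Poly_Mapping.keys H"
  proof
    fix \<epsilon> assume "\<epsilon> \<in> Poly_Mapping.keys (H * h \<kappa>)"
    then have "(\<Sum>\<gamma>\<in>Poly_Mapping.keys H. if \<gamma> + \<kappa> = \<epsilon> then Poly_Mapping.lookup H \<gamma> else 0) \<noteq> 0"
      by (simp add: in_keys_iff *)
    then obtain \<gamma> where "\<gamma> \<in> Poly_Mapping.keys H"
        "(if \<gamma> + \<kappa> = \<epsilon> then Poly_Mapping.lookup H \<gamma> else 0) \<noteq> 0"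
      by (rule sum.not_neutral_contains_not_neutral)
    then have "\<gamma> \<in> Poly_Mapping.keys H" "\<gamma> + \<kappa> = \<epsilon>" by (simp_all split: if_splits)
    then show "\<epsilon> \<in> (\<lambda>\<gamma>. \<gamma> + \<kappa>) ` Poly_Mapping.keys H" by auto
  qed
qed

text \<open>A part \<open>n\<close> appended to a content is the size of the last strip. Hence right
  multiplication by \<open>h \<kappa>\<close> is adjoint to the recursion that defines
  \<open>chains\<close>.\<close>

lemma pairing_mult_h_single:
  fixes H :: "'a::comm_ring_1 nsym"
  assumes "parts \<kappa> = [n]"
  shows "pairing (H * h \<kappa>) (dual_immaculate \<alpha>) =
    (\<Sum>\<delta> | strip_step {0} n \<delta> \<alpha>. pairing H (dual_immaculate \<delta>))"
proof -
  let ?K = "\<lambda>\<gamma> \<alpha>. of_nat (immaculate_kostka \<gamma> \<alpha>) :: 'a"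
  have inj: "inj_on (\<lambda>\<gamma>. \<gamma> + \<kappa>) X" for X :: "composition set"
    by (auto intro!: inj_onI simp flip: parts_inject)
  have "pairing (H * h \<kappa>) (dual_immaculate \<alpha>) =
      (\<Sum>\<epsilon>\<in>(\<lambda>\<gamma>. \<gamma> + \<kappa>) ` Poly_Mapping.keys H. Poly_Mapping.lookup (H * h \<kappa>) \<epsilon> * ?K \<epsilon> \<alpha>)"
    by (rule pairing_dual_immaculate) (simp_all add: keys_mult_h)
  also have "\<dots> = (\<Sum>\<gamma>\<in>Poly_Mapping.keys H. Poly_Mapping.lookup H \<gamma> * ?K (\<gamma> + \<kappa>) \<alpha>)"
    by (simp add: sum.reindex[OF inj] lookup_mult_h)
  also have "\<dots> = (\<Sum>\<gamma>\<in>Poly_Mapping.keys H. \<Sum>\<delta> | strip_step {0} n \<delta> \<alpha>.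
      Poly_Mapping.lookup H \<gamma> * ?K \<gamma> \<delta>)"
    by (simp add: immaculate_kostka_def assms sum_distrib_left)
  also have "\<dots> = (\<Sum>\<delta> | strip_step {0} n \<delta> \<alpha>. pairing H (dual_immaculate \<delta>))"
    by (subst sum.swap) (simp add: pairing_dual_immaculate[OF finite_keys subset_refl])
  finally show ?thesis .
qed

text \<open>The right Pieri rule, iterated over the parts of \<open>\<gamma>\<close> from the last
  one; the empty product is the duality of the two bases.\<close>

lemma pairing_immaculate_mult_h:
  "pairing (immaculate \<beta> * h \<gamma>) (dual_immaculate \<alpha>) =
    (of_nat (chains {0} \<beta> (rev (parts \<gamma>)) \<alpha>) :: 'a::comm_ring_1)"
proof (induction "parts \<gamma>" arbitrary: \<gamma> \<alpha> rule: rev_induct)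
  case Nil
  then have "\<gamma> = 0" by (simp flip: parts_inject)
  then show ?case by (auto simp: h_def pairing_immaculate)
next
  case (snoc n xs)
  have pos: "0 < n" "\<And>x. x \<in> set xs \<Longrightarrow> 0 < x"
    using snoc.hyps(2) parts_pos[of _ \<gamma>] by (auto simp flip: snoc.hyps(2))
  have p: "parts (Composition xs) = xs" "parts (Composition [n]) = [n]"
    using pos by (auto intro!: parts_Composition)
  then have \<gamma>: "\<gamma> = Composition xs + Composition [n]"
    using snoc.hyps(2) by (simp flip: parts_inject)
  have "pairing (immaculate \<beta> * h \<gamma>) (dual_immaculate \<alpha>) =
      pairing (immaculate \<beta> * h (Composition xs) * h (Composition [n])) (dual_immaculate \<alpha> :: 'a mfps)"
    by (simp add: \<gamma> h_mult mult.assoc)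
  also have "\<dots> = (\<Sum>\<delta> | strip_step {0} n \<delta> \<alpha>. of_nat (chains {0} \<beta> (rev xs) \<delta>))"
    using snoc.hyps(1)[of "Composition xs"] p by (simp add: pairing_mult_h_single)
  also have "\<dots> = of_nat (chains {0} \<beta> (rev (parts \<gamma>)) \<alpha>)"
    by (simp flip: snoc.hyps(2))
  finally show ?case .
qed

text \<open>A single \<open>\<gamma>\<close> contributes at \<open>m\<close>. No containment or size
  condition remains, because the chain count vanishes whenever one fails.\<close>

lemma skew_dual_immaculate_eq:
  "skew_dual_immaculate \<alpha> \<beta> m =
    (of_nat (chains {0} \<beta> (rev (nonzero_values m)) \<alpha>) :: 'a::comm_ring_1)"
proof (cases "\<beta> \<subseteq>\<^sub>c \<alpha>")
  case True
  let ?\<gamma> = "Composition (nonzero_values m)"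
  let ?c = "of_nat (chains {0} \<beta> (rev (nonzero_values m)) \<alpha>) :: 'a"
  have "parts \<gamma> = nonzero_values m \<longleftrightarrow> \<gamma> = ?\<gamma>" for \<gamma>
    by (metis parts_inverse parts_nonzero_values)
  then have "skew_dual_immaculate \<alpha> \<beta> m =
      (\<Sum>\<gamma> | csize \<gamma> = csize \<alpha> - csize \<beta>. if \<gamma> = ?\<gamma> then ?c else 0)"
    using True unfolding skew_dual_immaculate_def
    by (auto simp: pairing_immaculate_mult_h monomial_qsym_eq parts_nonzero_values intro!: sum.cong)
  also have "\<dots> = (if csize ?\<gamma> = csize \<alpha> - csize \<beta> then ?c else 0)"
    by (simp add: finite_csize)
  also have "\<dots> = ?c"
    using chains_nonzero[of "{0}" \<beta> "rev (nonzero_values m)" \<alpha>]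
    by (cases "chains {0} \<beta> (rev (nonzero_values m)) \<alpha> = 0")
       (simp_all add: csize_def parts_nonzero_values)
  finally show ?thesis .
next
  case False
  then have "chains {0} \<beta> (rev (nonzero_values m)) \<alpha> = 0"
    using chains_nonzero[of "{0}" \<beta> "rev (nonzero_values m)" \<alpha>] by (auto simp: diagram_subset_iff)
  with False show ?thesis by (simp add: skew_dual_immaculate_def)
qed


section \<open>Alternating sums over permutations\<close>

text \<open>Both permutations have the same sum of values over \<open>S\<close>, so no inequality
  can be strict.\<close>

lemma permutes_eqI_le:
  fixes \<sigma> \<pi> :: "nat \<Rightarrow> nat"
  assumes "\<sigma> permutes S" "\<pi> permutes S" "finite S" "\<And>j. j \<in> S \<Longrightarrow> \<sigma> j \<le> \<pi> j"
  shows "\<sigma> = \<pi>"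
proof (rule ccontr)
  assume "\<sigma> \<noteq> \<pi>"
  then obtain j where "\<sigma> j \<noteq> \<pi> j" by auto
  moreover from this have "j \<in> S" using assms(1,2) by (metis permutes_not_in)
  ultimately have "(\<Sum>j\<in>S. \<sigma> j) < (\<Sum>j\<in>S. \<pi> j)"
    using assms by (intro sum_strict_mono_ex1) (auto simp: le_less)
  moreover have "(\<Sum>j\<in>S. \<sigma> j) = (\<Sum>j\<in>S. \<pi> j)"
    using sum.permute[OF assms(1), of id] sum.permute[OF assms(2), of id] by simp
  ultimately show False by simp
qed

text \<open>These sums are the determinants of 0/1 matrices whose rows are initial segments of ones.\<close>

lemma sum_sign_bounded:
  assumes "\<pi> permutes {..<k}" "\<And>j. j < k \<Longrightarrow> c j = Suc (\<pi> j)"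
  shows "(\<Sum>\<sigma> | \<sigma> permutes {..<k} \<and> (\<forall>j<k. \<sigma> j < c j). sign \<sigma>) = sign \<pi>"
proof -
  have "{\<sigma>. \<sigma> permutes {..<k} \<and> (\<forall>j<k. \<sigma> j < c j)} = {\<pi>}"
    using assms permutes_eqI_le[of _ "{..<k}" \<pi>] by (auto simp: less_Suc_eq_le)
  then show ?thesis by simp
qed

text \<open>If \<open>c\<close> were injective without zeros, lowering its values by 1 would give a
  forbidden permutation. A zero bound admits no \<open>\<sigma>\<close>; two equal bounds allow a
  sign-reversing involution, composition with the transposition of their positions.\<close>

lemma sum_sign_bounded_eq_0:
  fixes c :: "nat \<Rightarrow> nat"
  assumes le: "\<And>j. j < k \<Longrightarrow> c j \<le> k"
    and no: "\<nexists>\<pi>. \<pi> permutes {..<k} \<and> (\<forall>j<k. c j = Suc (\<pi> j))"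
  shows "(\<Sum>\<sigma> | \<sigma> permutes {..<k} \<and> (\<forall>j<k. \<sigma> j < c j). sign \<sigma>) = 0"
    (is "sum sign ?X = 0")
proof (cases "inj_on c {..<k}")
  case True
  have "\<exists>j<k. c j = 0"
  proof (rule ccontr)
    assume "\<not> (\<exists>j<k. c j = 0)"
    then have pos: "0 < c j" if "j < k" for j using that by auto
    define \<pi> where "\<pi> j = (if j < k then c j - 1 else j)" for j
    have inj: "inj_on \<pi> {..<k}"
    proof (rule inj_onI)
      fix i j assume ij: "i \<in> {..<k}" "j \<in> {..<k}" "\<pi> i = \<pi> j"
      then have "c i = c j" using pos[of i] pos[of j] by (simp add: \<pi>_def)
      then show "i = j" using True ij by (auto dest: inj_onD)
    qed
    have "\<pi> j < k" if "j < k" for j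
      using le[OF that] pos[OF that] that by (simp add: \<pi>_def)
    then have "\<pi> ` {..<k} \<subseteq> {..<k}" by auto
    with inj have "\<pi> ` {..<k} = {..<k}" by (simp add: endo_inj_surj)
    with inj have "bij_betw \<pi> {..<k} {..<k}" by (simp add: bij_betw_def)
    then have "\<pi> permutes {..<k}" by (rule bij_imp_permutes) (simp add: \<pi>_def)
    moreover have "\<forall>j<k. c j = Suc (\<pi> j)" using pos by (simp add: \<pi>_def)
    ultimately show False using no by blast
  qed
  then have "?X = {}" by force
  then show ?thesis by (metis sum.empty)
next
  case False
  then obtain a b where ab: "a < k" "b < k" "a \<noteq> b" "c a = c b"
    by (auto simp: inj_on_def)
  let ?t = "transpose a b"
  have t: "?t permutes {..<k}" using ab by (intro permutes_swap_id) auto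
  have X: "\<sigma> \<circ> ?t \<in> ?X" if "\<sigma> \<in> ?X" for \<sigma>
  proof -
    have "(\<sigma> \<circ> ?t) j < c j" if "j < k" for j
    proof -
      have "?t j < k" using ab that by (auto simp: transpose_def)
      then have "\<sigma> (?t j) < c (?t j)" using \<open>\<sigma> \<in> ?X\<close> by auto
      also have "c (?t j) = c j" using ab by (auto simp: transpose_def)
      finally show ?thesis by simp
    qed
    then show ?thesis using that t by (auto intro: permutes_compose)
  qed
  have s: "sign (\<sigma> \<circ> ?t) = - sign \<sigma>" if "\<sigma> \<in> ?X" for \<sigma>
    using that ab by (auto simp: sign_compose permutes_imp_permutation[OF finite_lessThan]
        permutation_swap_id sign_swap_id)
  have tt: "\<sigma> \<circ> ?t \<circ> ?t = \<sigma>" for \<sigma> :: "nat \<Rightarrow> nat" by (simp add: fun_eq_iff)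
  have "sum sign ?X = (\<Sum>\<sigma>\<in>?X. sign (\<sigma> \<circ> ?t))"
    by (rule sum.reindex_bij_witness[of _ "\<lambda>\<sigma>. \<sigma> \<circ> ?t" "\<lambda>\<sigma>. \<sigma> \<circ> ?t"])
       (use X tt in \<open>auto simp del: o_apply\<close>)
  also have "\<dots> = - sum sign ?X" using s by (simp add: sum_negf)
  finally show ?thesis by simp
qed


section \<open>The dot action on shifted parts\<close>

text \<open>In these coordinates the action on compositions is precomposition with
  \<open>\<sigma>\<close>. Padding by zero parts makes partitions strictly decreasing on all indices
  and lets compositions of different lengths be compared.\<close>

definition shifted_part :: "composition \<Rightarrow> nat \<Rightarrow> int" where
  "shifted_part \<alpha> i = (if i < clength \<alpha> then int (cpart \<alpha> i) else 0) - int i"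

text \<open>Definedness needs no separate clause: the entries are the parts of the composition
  \<open>\<beta>\<close>, hence positive.\<close>

lemma perm_act_eq_Some_iff:
  assumes "\<sigma> permutes {..<clength \<alpha>}"
  shows "perm_act \<sigma> \<alpha> = Some \<beta> \<longleftrightarrow>
    clength \<beta> = clength \<alpha> \<and> shifted_part \<beta> = shifted_part \<alpha> \<circ> \<sigma>"
proof -
  let ?e = "perm_entries \<sigma> \<alpha>"
  have lt: "\<sigma> i < clength \<alpha>" if "i < clength \<alpha>" for i
    using permutes_in_image[OF assms, of i] that by simp
  have nth: "?e ! i = shifted_part \<alpha> (\<sigma> i) + int i" "length ?e = clength \<alpha>"
    if "i < clength \<alpha>" for i
    using that lt[OF that] by (simp_all add: perm_entries_def shifted_part_def)
  have len: "length ?e = clength \<alpha>" by (simp add: perm_entries_def)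
  have "perm_act \<sigma> \<alpha> = Some \<beta> \<longleftrightarrow> map int (parts \<beta>) = ?e"
  proof
    assume a: "perm_act \<sigma> \<alpha> = Some \<beta>"
    then have pos: "\<forall>z\<in>set ?e. 0 < z" and \<beta>: "\<beta> = Composition (map nat ?e)"
      by (auto simp: perm_act_def split: if_splits)
    have "parts \<beta> = map nat ?e" unfolding \<beta> using pos by (intro parts_Composition) auto
    then show "map int (parts \<beta>) = ?e" using pos by (auto intro!: map_idI simp: less_imp_le)
  next
    assume a: "map int (parts \<beta>) = ?e"
    then have "\<forall>z\<in>set ?e. 0 < z" using parts_pos[of _ \<beta>] by (auto simp flip: a)
    moreover have "map nat ?e = parts \<beta>" by (simp flip: a add: comp_def)
    ultimately show "perm_act \<sigma> \<alpha> = Some \<beta>" by (simp add: perm_act_def parts_inverse)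
  qed
  also have "\<dots> \<longleftrightarrow> clength \<beta> = clength \<alpha> \<and> (\<forall>i<clength \<alpha>. int (cpart \<beta> i) = ?e ! i)"
    by (auto simp: list_eq_iff_nth_eq len clength_def cpart_def)
  also have "\<dots> \<longleftrightarrow> clength \<beta> = clength \<alpha> \<and> shifted_part \<beta> = shifted_part \<alpha> \<circ> \<sigma>"
  proof (intro conj_cong refl)
    assume l: "clength \<beta> = clength \<alpha>"
    have "shifted_part \<beta> i = shifted_part \<alpha> (\<sigma> i)" if "\<not> i < clength \<alpha>" for i
      using permutes_not_in[OF assms, of i] that l by (simp add: shifted_part_def)
    moreover have "int (cpart \<beta> i) = ?e ! i \<longleftrightarrow> shifted_part \<beta> i = shifted_part \<alpha> (\<sigma> i)"
      if "i < clength \<alpha>" for i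
      using that l nth(1)[OF that] by (auto simp: shifted_part_def[of \<beta>])
    ultimately show "(\<forall>i<clength \<alpha>. int (cpart \<beta> i) = ?e ! i) \<longleftrightarrow>
        shifted_part \<beta> = shifted_part \<alpha> \<circ> \<sigma>"
      unfolding fun_eq_iff o_apply by metis
  qed
  finally show ?thesis .
qed

lemma csize_shifted_part:
  "int (csize \<alpha>) = (\<Sum>i<clength \<alpha>. shifted_part \<alpha> i) + (\<Sum>i<clength \<alpha>. int i)"
  by (simp add: csize_eq_sum shifted_part_def flip: sum.distrib)

lemma perm_act_csize:
  assumes "\<sigma> permutes {..<clength \<alpha>}" "perm_act \<sigma> \<alpha> = Some \<beta>"
  shows "csize \<beta> = csize \<alpha>"
proof -
  have "clength \<beta> = clength \<alpha>" "shifted_part \<beta> = shifted_part \<alpha> \<circ> \<sigma>"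
    using assms perm_act_eq_Some_iff by blast+
  then have "int (csize \<beta>) = int (csize \<alpha>)"
    using sum.permute[OF assms(1), of "shifted_part \<alpha>"] by (simp add: csize_shifted_part)
  then show ?thesis by simp
qed

lemma shifted_part_less:
  assumes "is_partition \<alpha>" "i < j"
  shows "shifted_part \<alpha> j < shifted_part \<alpha> i"
proof (cases "j < clength \<alpha>")
  case True
  then have "cpart \<alpha> j \<le> cpart \<alpha> i"
    using assms by (simp add: is_partition_def sorted_wrt_iff_nth_less clength_def cpart_def)
  with True assms(2) show ?thesis by (simp add: shifted_part_def)
qed (use assms(2) in \<open>simp add: shifted_part_def\<close>)

lemma shifted_part_less_iff:
  assumes "is_partition \<alpha>"
  shows "shifted_part \<alpha> j < shifted_part \<alpha> i \<longleftrightarrow> i < j"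
  using shifted_part_less[OF assms] by (metis less_asym linorder_neqE_nat order_less_irrefl)

text \<open>Shifted parts of a partition strictly decrease, so \<open>\<pi> i\<close> is the number
  of shifted parts of \<open>\<delta>\<close> exceeding the one at \<open>i\<close>. Thus
  \<open>\<delta>\<close> determines \<open>\<pi>\<close>, and undoing \<open>\<pi>\<close>
  determines \<open>\<rho>\<close>.\<close>

lemma perm_act_unique:
  assumes \<rho>: "is_partition \<rho>" "\<pi> permutes {..<clength \<rho>}" "perm_act \<pi> \<rho> = Some \<delta>"
    and \<rho>': "is_partition \<rho>'" "\<pi>' permutes {..<clength \<rho>'}" "perm_act \<pi>' \<rho>' = Some \<delta>"
  shows "\<rho> = \<rho>'" "\<pi> = \<pi>'"
proof -
  have rank: "\<pi> i = card {l. shifted_part \<delta> i < shifted_part \<delta> l}"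
    if "is_partition \<rho>" "\<pi> permutes {..<clength \<rho>}" "perm_act \<pi> \<rho> = Some \<delta>" for \<pi> \<rho> i
  proof -
    have "{l. shifted_part \<delta> i < shifted_part \<delta> l} = \<pi> -` {..<\<pi> i}"
      using that by (auto simp: perm_act_eq_Some_iff shifted_part_less_iff)
    moreover have "card (\<pi> -` {..<\<pi> i}) = card {..<\<pi> i}"
      using permutes_inj[OF that(2)] permutes_surj[OF that(2)] by (intro card_vimage_inj) auto
    ultimately show ?thesis by simp
  qed
  show \<pi>: "\<pi> = \<pi>'" using rank[OF \<rho>] rank[OF \<rho>'] by auto
  have len: "clength \<rho> = clength \<rho>'" and "shifted_part \<rho> \<circ> \<pi> = shifted_part \<rho>' \<circ> \<pi>"
    using \<rho> \<rho>' \<pi> by (auto simp: perm_act_eq_Some_iff)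
  then have eq: "shifted_part \<rho> i = shifted_part \<rho>' i" for i
    using permutes_surj[OF \<rho>(2)] by (metis comp_apply surjD)
  show "\<rho> = \<rho>'"
  proof (rule composition_eqI[OF len])
    fix i assume "i < clength \<rho>"
    with eq[of i] len show "cpart \<rho> i = cpart \<rho>' i" by (simp add: shifted_part_def)
  qed
qed


section \<open>Alternating sums of strips\<close>

text \<open>The length hypotheses account for the column condition and \<open>size\<close> for the
  number of cells, which leaves containment. The inequalities also force all entries of the permuted
  composition to be positive, so that it is defined.\<close>

lemma strip_step_perm_act_iff:
  assumes \<sigma>: "\<sigma> permutes {..<clength la}"
    and len: "clength \<delta> \<le> clength la" "clength la \<le> Suc (clength \<delta>)"
    and size: "csize la = csize \<delta> + n"
  shows "(\<exists>\<alpha>. perm_act \<sigma> la = Some \<alpha> \<and> strip_step {0} n \<delta> \<alpha>) \<longleftrightarrow>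
    (\<forall>j<clength la. shifted_part \<delta> j \<le> shifted_part la (\<sigma> j))"
proof
  assume "\<exists>\<alpha>. perm_act \<sigma> la = Some \<alpha> \<and> strip_step {0} n \<delta> \<alpha>"
  then obtain \<alpha> where \<alpha>: "perm_act \<sigma> la = Some \<alpha>" and "strip_step {0} n \<delta> \<alpha>" by blast
  then have sub: "\<delta> \<subseteq>\<^sub>c \<alpha>" by (simp add: strip_step_def flip: diagram_subset_iff)
  have "clength \<alpha> = clength la" "shifted_part la (\<sigma> j) = shifted_part \<alpha> j" for j
    using \<alpha> \<sigma> by (simp_all add: perm_act_eq_Some_iff)
  then show "\<forall>j<clength la. shifted_part \<delta> j \<le> shifted_part la (\<sigma> j)"
    using sub by (auto simp: shifted_part_def csubset_def)
next
  assume le: "\<forall>j<clength la. shifted_part \<delta> j \<le> shifted_part la (\<sigma> j)"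
  have pos: "0 < shifted_part la (\<sigma> j) + int j" if j: "j < clength la" for j
  proof (cases "j < clength \<delta>")
    case True
    then show ?thesis using le j cpart_pos[OF True] by (auto simp: shifted_part_def[of \<delta>])
  next
    case False
    \<comment> \<open>Only the top row can be missing from \<open>\<delta>\<close>. There
      \<open>\<sigma> j \<le> j\<close>, so the entry is at least a part of
      \<open>la\<close>.\<close>
    then have "j = clength la - 1" using len j by simp
    moreover have "\<sigma> j < clength la" using permutes_in_image[OF \<sigma>, of j] j by simp
    ultimately show ?thesis using cpart_pos[of "\<sigma> j" la] by (simp add: shifted_part_def)
  qed
  obtain \<alpha> where \<alpha>: "clength \<alpha> = clength la"
      "\<And>j. j < clength la \<Longrightarrow> cpart \<alpha> j = nat (shifted_part la (\<sigma> j) + int j)"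
    using ex_composition[of "clength la" "\<lambda>j. nat (shifted_part la (\<sigma> j) + int j)"] pos by auto
  have sh: "shifted_part \<alpha> j = shifted_part la (\<sigma> j)" for j
    using \<alpha> pos[of j] permutes_not_in[OF \<sigma>, of j] by (auto simp: shifted_part_def[of \<alpha>])
       (auto simp: shifted_part_def)
  then have act: "perm_act \<sigma> la = Some \<alpha>"
    using \<sigma> \<alpha>(1) by (auto simp: perm_act_eq_Some_iff)
  have "cpart \<delta> j \<le> cpart \<alpha> j" if "j < clength \<delta>" for j
  proof -
    have "shifted_part \<delta> j \<le> shifted_part \<alpha> j" using le sh that len by simp
    then show ?thesis using that len \<alpha>(1) by (simp add: shifted_part_def)
  qed
  then have "\<delta> \<subseteq>\<^sub>c \<alpha>" using len \<alpha> by (simp add: csubset_def)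
  then have "strip_step {0} n \<delta> \<alpha>"
    using perm_act_csize[OF \<sigma> act] size len \<alpha>(1)
    by (auto simp: strip_step_def diagram_col0 simp flip: diagram_subset_iff)
  with act show "\<exists>\<alpha>. perm_act \<sigma> la = Some \<alpha> \<and> strip_step {0} n \<delta> \<alpha>" by blast
qed

text \<open>The bound on \<open>\<sigma> j\<close>: shifted parts of the partition \<open>la\<close>
  decrease, so the indices counted form an initial segment.\<close>

definition dominating_count :: "composition \<Rightarrow> composition \<Rightarrow> nat \<Rightarrow> nat" where
  "dominating_count la \<delta> j = card {i. i < clength la \<and> shifted_part \<delta> j \<le> shifted_part la i}"

lemma dominating_count_le: "dominating_count la \<delta> j \<le> clength la"
proof -
  have "dominating_count la \<delta> j \<le> card {..<clength la}"
    unfolding dominating_count_def by (rule card_mono) auto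
  then show ?thesis by simp
qed

lemma less_dominating_count_iff:
  assumes "is_partition la" "i < clength la"
  shows "i < dominating_count la \<delta> j \<longleftrightarrow> shifted_part \<delta> j \<le> shifted_part la i"
proof -
  have "{i. i < clength la \<and> shifted_part \<delta> j \<le> shifted_part la i} = {..<dominating_count la \<delta> j}"
    unfolding dominating_count_def
    by (rule down_closed_eq_lessThan) (auto dest: shifted_part_less[OF assms(1)])
  then show ?thesis using assms(2) by auto
qed

section \<open>Horizontal strips and the bounds they produce\<close>

lemma strip_step_UNIV_partition:
  "strip_step UNIV n \<rho> la \<Longrightarrow> is_partition la \<Longrightarrow> is_partition \<rho>"
  using strip_step_closed columns_closed_UNIV by blast

lemma strip_step_UNIV_clength:
  assumes "strip_step UNIV n \<rho> la"
  shows "clength \<rho> \<le> clength la" "clength la \<le> Suc (clength \<rho>)"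
proof -
  show "clength \<rho> \<le> clength la"
    using assms by (simp add: strip_step_def diagram_subset_iff csubset_def)
  show "clength la \<le> Suc (clength \<rho>)"
  proof (rule ccontr)
    assume "\<not> clength la \<le> Suc (clength \<rho>)"
    then have "(Suc (clength \<rho>), 0) \<in> diagram la" by (simp add: diagram_col0)
    then have "(clength \<rho>, 0) \<in> diagram \<rho>" using assms lessI unfolding strip_step_def by blast
    then show False by (simp add: diagram_col0)
  qed
qed

text \<open>In a horizontal strip, row \<open>p\<close> of \<open>\<rho>\<close> is at most row
  \<open>p\<close> of \<open>la\<close> and at least every higher row of \<open>la\<close>. After
  shifting, exactly the indices \<open>0\<close> to \<open>p\<close> dominate, which makes
  \<open>Suc p\<close> of them.\<close>

lemma strip_step_UNIV_dominating_count:
  assumes la: "is_partition la" and s: "strip_step UNIV n \<rho> la"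
    and \<pi>: "\<pi> permutes {..<clength \<rho>}" and act: "perm_act \<pi> \<rho> = Some \<delta>"
  shows "\<pi> permutes {..<clength la}"
    and "j < clength la \<Longrightarrow> dominating_count la \<delta> j = Suc (\<pi> j)"
proof -
  have sub: "\<rho> \<subseteq>\<^sub>c la" using s by (simp add: strip_step_def diagram_subset_iff)
  show \<pi>': "\<pi> permutes {..<clength la}"
    using \<pi> strip_step_UNIV_clength(1)[OF s] by (auto intro: permutes_subset)
  assume "j < clength la"
  let ?p = "\<pi> j"
  have p: "?p < clength la" using permutes_in_image[OF \<pi>', of j] \<open>j < clength la\<close> by simp
  have sh: "shifted_part \<delta> j = shifted_part \<rho> ?p"
    using act \<pi> by (simp add: perm_act_eq_Some_iff)
  have le: "shifted_part \<rho> ?p \<le> shifted_part la ?p"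
    using sub by (auto simp: shifted_part_def csubset_def)
  have lt: "shifted_part la i < shifted_part \<rho> ?p" if i: "i < clength la" "?p < i" for i
  proof -
    have "(i, cpart la i - 1) \<in> diagram la"
      using i cpart_pos[of i la] by (simp add: diagram_iff)
    then have "(?p, cpart la i - 1) \<in> diagram \<rho>" using s i unfolding strip_step_def by blast
    then show ?thesis using i by (simp add: diagram_iff shifted_part_def) linarith
  qed
  have "i < dominating_count la \<delta> j \<longleftrightarrow> i < Suc ?p" if i: "i < clength la" for i
  proof -
    have "shifted_part la ?p \<le> shifted_part la i" if "i \<le> ?p"
      using that shifted_part_less[OF la, of i ?p] by (cases "i = ?p") auto
    then have "shifted_part \<rho> ?p \<le> shifted_part la i \<longleftrightarrow> i \<le> ?p"
      using lt[OF i] le by (cases "i \<le> ?p") auto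
    then show ?thesis using less_dominating_count_iff[OF la i] sh by (simp add: less_Suc_eq_le)
  qed
  then show "dominating_count la \<delta> j = Suc ?p"
    using dominating_count_le[of la \<delta> j] p
    by (metis Suc_leI le_less_linear less_irrefl linorder_neqE_nat order_less_le_trans)
qed

text \<open>Conversely, undoing \<open>\<pi>\<close> on the shifted parts of \<open>\<delta>\<close>
  gives the candidate rows \<open>r p\<close>. A count of exactly \<open>Suc p\<close> says that
  index \<open>p\<close> dominates and \<open>Suc p\<close> does not, which is the interlacing
  \<open>r_le\<close> and \<open>r_ge\<close>.\<close>

lemma ex_strip_step_UNIV:
  assumes la: "is_partition la"
    and len: "clength \<delta> \<le> clength la" "clength la \<le> Suc (clength \<delta>)"
    and size: "csize la = csize \<delta> + n"
    and \<pi>: "\<pi> permutes {..<clength la}"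
    and c: "\<And>j. j < clength la \<Longrightarrow> dominating_count la \<delta> j = Suc (\<pi> j)"
  obtains \<rho> where "strip_step UNIV n \<rho> la" "\<pi> permutes {..<clength \<rho>}" "perm_act \<pi> \<rho> = Some \<delta>"
proof -
  let ?k = "clength la" and ?l = "clength \<delta>"
  define r where "r p = shifted_part \<delta> (inv \<pi> p) + int p" for p
  have inv: "inv \<pi> p < ?k" "\<pi> (inv \<pi> p) = p" if "p < ?k" for p
    using that permutes_in_image[OF permutes_inv[OF \<pi>], of p] permutes_inverses(1)[OF \<pi>] by auto
  have r_le: "r p \<le> int (cpart la p)" if "p < ?k" for p
    using less_dominating_count_iff[OF la that, of \<delta> "inv \<pi> p"] c[OF inv(1)[OF that]] inv(2)[OF that] that
    by (simp add: r_def shifted_part_def[of la])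
  have r_ge: "int (cpart la (Suc p)) \<le> r p" if "Suc p < ?k" for p
    using less_dominating_count_iff[OF la that, of \<delta> "inv \<pi> p"] c[of "inv \<pi> p"] inv[of p] that
    by (simp add: r_def shifted_part_def[of la])
  \<comment> \<open>If \<open>\<delta>\<close> lacks the top row, index \<open>?l\<close> of
    \<open>la\<close> dominates the padded part there, so \<open>\<pi>\<close> fixes
    \<open>?l\<close> and permutes the rows of \<open>\<delta>\<close>.\<close>
  have \<pi>l: "\<pi> permutes {..<?l}"
  proof (cases "?l = ?k")
    case False
    then have k: "?k = Suc ?l" using len by simp
    have "?l < dominating_count la \<delta> ?l"
      using less_dominating_count_iff[OF la, of ?l \<delta> ?l] k by (simp add: shifted_part_def)
    then have "\<pi> ?l = ?l"
      using c[of ?l] k permutes_in_image[OF \<pi>, of ?l] by simp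
    then show ?thesis using \<pi> k by (intro permutes_superset[OF \<pi>]) (auto simp: less_Suc_eq)
  qed (use \<pi> in simp)
  have r_pos: "0 < r p" if "p < ?l" for p
  proof (cases "Suc p < ?k")
    case True
    then show ?thesis using r_ge[OF True] cpart_pos[OF True] by linarith
  next
    case False
    \<comment> \<open>No higher row of \<open>la\<close> bounds \<open>r p\<close> from below.
      Instead \<open>inv \<pi> p \<le> p\<close>, so \<open>r p\<close> is at least a part of
      \<open>\<delta>\<close>.\<close>
    then have p: "p < ?k" "p = ?k - 1" using that len by auto
    have "inv \<pi> p < ?l" using permutes_in_image[OF permutes_inv[OF \<pi>l], of p] that by simp
    then show ?thesis
      using cpart_pos[of "inv \<pi> p" \<delta>] inv(1)[OF p(1)] p by (simp add: r_def shifted_part_def)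
  qed
  obtain \<rho> where \<rho>: "clength \<rho> = ?l" "\<And>p. p < ?l \<Longrightarrow> cpart \<rho> p = nat (r p)"
    using ex_composition[of ?l "\<lambda>p. nat (r p)"] r_pos by auto
  have \<rho>r: "int (cpart \<rho> p) = r p" if "p < ?l" for p
    using \<rho>(2)[OF that] r_pos[OF that] by simp
  have "shifted_part \<delta> j = shifted_part \<rho> (\<pi> j)" for j
  proof (cases "j < ?l")
    case True
    then have "\<pi> j < ?l" using permutes_in_image[OF \<pi>l, of j] by simp
    then show ?thesis
      using \<rho>r[of "\<pi> j"] \<rho>(1) permutes_inverses(2)[OF \<pi>] by (simp add: shifted_part_def[of \<rho>] r_def)
  next
    case False
    then show ?thesis using permutes_not_in[OF \<pi>l, of j] \<rho>(1) by (simp add: shifted_part_def)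
  qed
  then have act: "perm_act \<pi> \<rho> = Some \<delta>"
    using \<pi>l \<rho>(1) by (auto simp: perm_act_eq_Some_iff)
  have "\<rho> \<subseteq>\<^sub>c la"
    unfolding csubset_def
  proof (intro conjI allI impI)
    fix j assume "j < clength \<rho>"
    then show "cpart \<rho> j \<le> cpart la j" using \<rho>r[of j] r_le[of j] \<rho>(1) len by simp
  qed (use \<rho> len in simp)
  moreover have "csize la = csize \<rho> + n"
    using perm_act_csize[OF _ act] \<pi>l \<rho>(1) size by simp
  moreover have "(i, j) \<in> diagram \<rho>" if "i < i'" "(i', j) \<in> diagram la" for i i' j
  proof -
    have "Suc i < ?k" "i < ?l" using that len by (auto simp: diagram_iff)
    moreover have "(Suc i, j) \<in> diagram la"
    proof (cases "i' = Suc i")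
      case False
      then have "Suc i < i'" using that by simp
      then show ?thesis using that la columns_closed_UNIV[of la] unfolding columns_closed_def by blast
    qed (use that in simp)
    ultimately show ?thesis using r_ge[of i] \<rho>r[of i] \<rho>(1) by (simp add: diagram_iff)
  qed
  ultimately have "strip_step UNIV n \<rho> la"
    by (simp add: strip_step_def diagram_subset_iff)
  then show ?thesis using that \<pi>l act \<rho>(1) by simp
qed

text \<open>The exchange rule for one step: alternating over \<open>la\<close> and then removing an
  immaculate strip agrees with removing a horizontal strip and then alternating. For a fixed
  \<open>\<delta>\<close> both sides are 0 or the same single sign.\<close>

lemma sum_sign_strip_step:
  assumes la: "is_partition la"
  shows "(\<Sum>\<sigma> | \<sigma> permutes {..<clength la}. sign \<sigma> *
      (case perm_act \<sigma> la of None \<Rightarrow> 0 | Some \<alpha> \<Rightarrow> if strip_step {0} n \<delta> \<alpha> then 1 else 0)) =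
    (\<Sum>\<rho> | strip_step UNIV n \<rho> la. \<Sum>\<pi> | \<pi> permutes {..<clength \<rho>}.
      sign \<pi> * (if perm_act \<pi> \<rho> = Some \<delta> then 1 else 0))"
    (is "?L = ?R")
proof -
  let ?k = "clength la" and ?c = "dominating_count la \<delta>"
  define Z where "Z = {(\<rho>, \<pi>). strip_step UNIV n \<rho> la \<and> \<pi> permutes {..<clength \<rho>} \<and>
    perm_act \<pi> \<rho> = Some \<delta>}"
  let ?S = "SIGMA \<rho>:{\<rho>. strip_step UNIV n \<rho> la}. {\<pi>. \<pi> permutes {..<clength \<rho>}}"
  have fin: "finite {\<rho>. strip_step UNIV n \<rho> la}" by (rule finite_strip_step)
  have "?R = (\<Sum>(\<rho>, \<pi>)\<in>?S. sign \<pi> * (if perm_act \<pi> \<rho> = Some \<delta> then 1 else 0))"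
    using fin by (intro sum.Sigma) (auto simp: finite_permutations)
  also have "\<dots> = (\<Sum>(\<rho>, \<pi>)\<in>Z. sign \<pi>)"
    using fin by (intro sum.mono_neutral_cong_right finite_SigmaI)
      (auto simp: Z_def finite_permutations split: if_splits)
  finally have R: "?R = (\<Sum>(\<rho>, \<pi>)\<in>Z. sign \<pi>)" .
  have unique: "\<rho> = \<rho>' \<and> \<pi> = \<pi>'" if "(\<rho>, \<pi>) \<in> Z" "(\<rho>', \<pi>') \<in> Z" for \<rho> \<pi> \<rho>' \<pi>'
    using that perm_act_unique[of \<rho> \<pi> \<delta> \<rho>' \<pi>'] strip_step_UNIV_partition[OF _ la]
    unfolding Z_def by blast
  show ?thesis
  \<comment> \<open>These length and size conditions are necessary for a nonzero term on either
    side.\<close>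
  proof (cases "clength \<delta> \<le> ?k \<and> ?k \<le> Suc (clength \<delta>) \<and> csize la = csize \<delta> + n")
    case True
    then have len: "clength \<delta> \<le> ?k" "?k \<le> Suc (clength \<delta>)" and size: "csize la = csize \<delta> + n"
      by auto
    have iff: "(\<exists>\<alpha>. perm_act \<sigma> la = Some \<alpha> \<and> strip_step {0} n \<delta> \<alpha>) \<longleftrightarrow> (\<forall>j<?k. \<sigma> j < ?c j)"
      if \<sigma>: "\<sigma> permutes {..<?k}" for \<sigma>
    proof -
      have "\<sigma> j < ?k" if "j < ?k" for j using permutes_in_image[OF \<sigma>, of j] that by simp
      then show ?thesis
        using strip_step_perm_act_iff[OF \<sigma> len size] less_dominating_count_iff[OF la] by simp
    qed
    have "?L = (\<Sum>\<sigma> | \<sigma> permutes {..<?k}. if \<forall>j<?k. \<sigma> j < ?c j then sign \<sigma> else 0)"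
    proof (intro sum.cong refl)
      fix \<sigma> assume "\<sigma> \<in> {\<sigma>. \<sigma> permutes {..<?k}}"
      then show "sign \<sigma> * (case perm_act \<sigma> la of None \<Rightarrow> 0
          | Some \<alpha> \<Rightarrow> if strip_step {0} n \<delta> \<alpha> then 1 else 0) =
          (if \<forall>j<?k. \<sigma> j < ?c j then sign \<sigma> else 0)"
        by (subst iff[symmetric]) (auto split: option.splits)
    qed
    also have "\<dots> = (\<Sum>\<sigma> | \<sigma> permutes {..<?k} \<and> (\<forall>j<?k. \<sigma> j < ?c j). sign \<sigma>)"
      by (simp add: sum.If_cases finite_permutations Int_def)
    finally have L: "?L = (\<Sum>\<sigma> | \<sigma> permutes {..<?k} \<and> (\<forall>j<?k. \<sigma> j < ?c j). sign \<sigma>)" .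
    show ?thesis
    proof (cases "\<exists>\<pi>. \<pi> permutes {..<?k} \<and> (\<forall>j<?k. ?c j = Suc (\<pi> j))")
      case True
      then obtain \<pi> where \<pi>: "\<pi> permutes {..<?k}" "\<And>j. j < ?k \<Longrightarrow> ?c j = Suc (\<pi> j)" by blast
      obtain \<rho> where "strip_step UNIV n \<rho> la" "\<pi> permutes {..<clength \<rho>}" "perm_act \<pi> \<rho> = Some \<delta>"
        using ex_strip_step_UNIV[OF la len size \<pi>] by blast
      then have "(\<rho>, \<pi>) \<in> Z" by (simp add: Z_def)
      with unique have "Z = {(\<rho>, \<pi>)}" by auto
      then show ?thesis using L R sum_sign_bounded[OF \<pi>] by simp
    next
      case False
      then have "Z = {}"
        using strip_step_UNIV_dominating_count[OF la] by (fastforce simp: Z_def)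
      then show ?thesis using L R sum_sign_bounded_eq_0[OF dominating_count_le False] by simp
    qed
  next
    case False
    have "Z = {}"
    proof -
      have False if s: "strip_step UNIV n \<rho> la" and \<pi>: "\<pi> permutes {..<clength \<rho>}"
        and act: "perm_act \<pi> \<rho> = Some \<delta>" for \<rho> \<pi>
      proof -
        have "clength \<delta> = clength \<rho>" "csize \<delta> = csize \<rho>"
          using perm_act_csize[OF \<pi> act] act \<pi> by (simp_all add: perm_act_eq_Some_iff)
        then show False
          using False strip_step_UNIV_clength[OF s] s by (simp add: strip_step_def)
      qed
      then show ?thesis by (auto simp: Z_def)
    qed
    moreover have "?L = 0"
    proof (intro sum.neutral ballI)
      fix \<sigma> assume "\<sigma> \<in> {\<sigma>. \<sigma> permutes {..<?k}}"
      then have \<sigma>: "\<sigma> permutes {..<?k}" by simp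
      have "\<not> strip_step {0} n \<delta> \<alpha>" if act: "perm_act \<sigma> la = Some \<alpha>" for \<alpha>
      proof
        assume s: "strip_step {0} n \<delta> \<alpha>"
        have "clength \<alpha> = ?k" "csize \<alpha> = csize la"
          using perm_act_csize[OF \<sigma> act] act \<sigma> by (simp_all add: perm_act_eq_Some_iff)
        moreover have "clength \<alpha> \<le> Suc (clength \<delta>)"
          using strip_step_0_row_weight(1)[OF s] by simp
        moreover have "clength \<delta> \<le> clength \<alpha>"
          using s by (simp add: strip_step_def diagram_subset_iff csubset_def)
        ultimately show False using False s by (simp add: strip_step_def)
      qed
      then show "sign \<sigma> * (case perm_act \<sigma> la of None \<Rightarrow> 0
          | Some \<alpha> \<Rightarrow> if strip_step {0} n \<delta> \<alpha> then 1 else 0) = 0"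
        by (auto split: option.splits)
    qed
    ultimately show ?thesis using R by simp
  qed
qed

text \<open>The exchange rule moves the alternating sum past one strip at a time, from the last to
  the first. At the empty chain, uniqueness leaves only \<open>la = \<mu>\<close> and
  \<open>\<sigma> = \<tau>\<close>, whence the factor \<open>sign \<tau>\<close>.\<close>

lemma sum_sign_chains:
  assumes \<mu>: "is_partition \<mu>" "\<tau> permutes {..<clength \<mu>}" "perm_act \<tau> \<mu> = Some \<nu>"
    and "is_partition la"
  shows "(\<Sum>\<sigma> | \<sigma> permutes {..<clength la}. sign \<sigma> *
      (case perm_act \<sigma> la of None \<Rightarrow> 0 | Some \<alpha> \<Rightarrow> int (chains {0} \<nu> g \<alpha>))) =
    sign \<tau> * int (chains UNIV \<mu> g la)"
  using assms(4)
proof (induction g arbitrary: la)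
  case Nil
  have "(\<Sum>\<sigma> | \<sigma> permutes {..<clength la}. sign \<sigma> *
      (case perm_act \<sigma> la of None \<Rightarrow> 0 | Some \<alpha> \<Rightarrow> int (chains {0} \<nu> [] \<alpha>))) =
      (\<Sum>\<sigma> | \<sigma> permutes {..<clength la}. if \<sigma> = \<tau> then if la = \<mu> then sign \<tau> else 0 else 0)"
  proof (intro sum.cong refl)
    fix \<sigma> assume "\<sigma> \<in> {\<sigma>. \<sigma> permutes {..<clength la}}"
    then have "perm_act \<sigma> la = Some \<nu> \<longleftrightarrow> la = \<mu> \<and> \<sigma> = \<tau>"
      using perm_act_unique[OF \<mu> Nil, of \<sigma>] \<mu> by auto
    then show "sign \<sigma> * (case perm_act \<sigma> la of None \<Rightarrow> 0 | Some \<alpha> \<Rightarrow> int (chains {0} \<nu> [] \<alpha>)) =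
        (if \<sigma> = \<tau> then if la = \<mu> then sign \<tau> else 0 else 0)"
      by (auto split: option.splits)
  qed
  also have "\<dots> = sign \<tau> * int (chains UNIV \<mu> [] la)"
    using \<mu>(2) by (auto simp: finite_permutations)
  finally show ?case .
next
  case (Cons n g)
  let ?K = "\<lambda>\<delta>. int (chains {0} \<nu> g \<delta>)"
  let ?P = "\<lambda>\<alpha>. {\<sigma>. \<sigma> permutes {..<clength \<alpha>}}"
  \<comment> \<open>A range for \<open>\<delta>\<close> that does not depend on
    \<open>\<sigma>\<close>, so that the sums can be interchanged. It contains every
    \<open>\<delta>\<close> that occurs, since permuting preserves the size.\<close>
  let ?D = "{\<delta>. csize la = csize \<delta> + n}"
  let ?E = "\<lambda>\<sigma> \<delta>. case perm_act \<sigma> la of None \<Rightarrow> 0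
    | Some \<alpha> \<Rightarrow> if strip_step {0} n \<delta> \<alpha> then 1 else (0 :: int)"
  have finD: "finite ?D" by (rule finite_subset[OF _ finite_csize[of "csize la - n"]]) auto
  have "(\<Sum>\<sigma>\<in>?P la. sign \<sigma> *
      (case perm_act \<sigma> la of None \<Rightarrow> 0 | Some \<alpha> \<Rightarrow> int (chains {0} \<nu> (n # g) \<alpha>))) =
      (\<Sum>\<sigma>\<in>?P la. \<Sum>\<delta>\<in>?D. ?K \<delta> * (sign \<sigma> * ?E \<sigma> \<delta>))"
  proof (intro sum.cong refl)
    fix \<sigma> assume "\<sigma> \<in> ?P la"
    then have \<sigma>: "\<sigma> permutes {..<clength la}" by simp
    show "sign \<sigma> * (case perm_act \<sigma> la of None \<Rightarrow> 0 | Some \<alpha> \<Rightarrow> int (chains {0} \<nu> (n # g) \<alpha>)) =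
        (\<Sum>\<delta>\<in>?D. ?K \<delta> * (sign \<sigma> * ?E \<sigma> \<delta>))"
    proof (cases "perm_act \<sigma> la")
      case (Some \<alpha>)
      have "int (chains {0} \<nu> (n # g) \<alpha>) = (\<Sum>\<delta> | strip_step {0} n \<delta> \<alpha>. ?K \<delta>)" by simp
      also have "\<dots> = (\<Sum>\<delta>\<in>?D. ?K \<delta> * (if strip_step {0} n \<delta> \<alpha> then 1 else 0))"
        using perm_act_csize[OF \<sigma> Some] finD
        by (intro sum.mono_neutral_cong_left) (auto simp: strip_step_def)
      finally show ?thesis by (simp add: Some sum_distrib_left mult.left_commute)
    qed simp
  qed
  also have "\<dots> = (\<Sum>\<delta>\<in>?D. ?K \<delta> * (\<Sum>\<sigma>\<in>?P la. sign \<sigma> * ?E \<sigma> \<delta>))"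
    by (subst sum.swap) (simp add: sum_distrib_left)
  also have "\<dots> = (\<Sum>\<delta>\<in>?D. \<Sum>\<rho> | strip_step UNIV n \<rho> la. \<Sum>\<pi>\<in>?P \<rho>.
      sign \<pi> * (if perm_act \<pi> \<rho> = Some \<delta> then ?K \<delta> else 0))"
    unfolding sum_sign_strip_step[OF Cons.prems] sum_distrib_left
    by (intro sum.cong refl) simp
  also have "\<dots> = (\<Sum>\<rho> | strip_step UNIV n \<rho> la. \<Sum>\<pi>\<in>?P \<rho>.
      sign \<pi> * (\<Sum>\<delta>\<in>?D. if perm_act \<pi> \<rho> = Some \<delta> then ?K \<delta> else 0))"
    unfolding sum_distrib_left by (subst sum.swap) (intro sum.cong refl sum.swap)
  also have "\<dots> = (\<Sum>\<rho> | strip_step UNIV n \<rho> la. \<Sum>\<pi>\<in>?P \<rho>.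
      sign \<pi> * (case perm_act \<pi> \<rho> of None \<Rightarrow> 0 | Some \<alpha> \<Rightarrow> ?K \<alpha>))"
  proof (intro sum.cong refl arg_cong2[where f = "(*)"])
    fix \<rho> \<pi> assume "\<rho> \<in> {\<rho>. strip_step UNIV n \<rho> la}" "\<pi> \<in> ?P \<rho>"
    then have s: "csize la = csize \<rho> + n" and \<pi>: "\<pi> permutes {..<clength \<rho>}"
      by (auto simp: strip_step_def)
    show "(\<Sum>\<delta>\<in>?D. if perm_act \<pi> \<rho> = Some \<delta> then ?K \<delta> else 0) =
        (case perm_act \<pi> \<rho> of None \<Rightarrow> 0 | Some \<alpha> \<Rightarrow> ?K \<alpha>)"
      using perm_act_csize[OF \<pi>] s finD by (cases "perm_act \<pi> \<rho>") auto
  qed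
  also have "\<dots> = (\<Sum>\<rho> | strip_step UNIV n \<rho> la. sign \<tau> * int (chains UNIV \<mu> g \<rho>))"
    using Cons.IH strip_step_UNIV_partition[OF _ Cons.prems] by (intro sum.cong refl) simp
  also have "\<dots> = sign \<tau> * int (chains UNIV \<mu> (n # g) la)"
    by (simp add: sum_distrib_left)
  finally show ?case .
qed

theorem theorem4p12:
  fixes la \<mu> \<nu> :: composition and \<tau> :: "nat \<Rightarrow> nat"
  assumes "is_partition la" and "is_partition \<mu>" and "\<mu> \<subseteq>\<^sub>c la"
    and "\<tau> permutes {..<clength \<mu>}" and "perm_act \<tau> \<mu> = Some \<nu>"
  shows "(skew_schur la \<mu> :: 'a::comm_ring_1 mfps) =
    (\<lambda>m. \<Sum>\<sigma> | \<sigma> permutes {..<clength la}.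
       of_int (sign \<sigma>) * of_int (sign \<tau>) *
       (case perm_act \<sigma> la of None \<Rightarrow> 0 | Some \<alpha> \<Rightarrow> skew_dual_immaculate \<alpha> \<nu> m))"
proof
  fix m
  let ?g = "rev (nonzero_values m)"
  \<comment> \<open>At each exponent vector the identity comes from one between integers, carried
    into the coefficient ring by \<open>of_int\<close>.\<close>
  have "(\<Sum>\<sigma> | \<sigma> permutes {..<clength la}. of_int (sign \<sigma>) * of_int (sign \<tau>) *
      (case perm_act \<sigma> la of None \<Rightarrow> 0 | Some \<alpha> \<Rightarrow> skew_dual_immaculate \<alpha> \<nu> m)) =
      (of_int (sign \<tau> * (\<Sum>\<sigma> | \<sigma> permutes {..<clength la}. sign \<sigma> *
        (case perm_act \<sigma> la of None \<Rightarrow> 0 | Some \<alpha> \<Rightarrow> int (chains {0} \<nu> ?g \<alpha>)))) :: 'a)"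
    unfolding of_int_mult of_int_sum sum_distrib_left
    by (intro sum.cong refl) (auto simp: skew_dual_immaculate_eq split: option.splits)
  also have "\<dots> = of_int (sign \<tau> * sign \<tau> * int (chains UNIV \<mu> ?g la))"
    unfolding mult.assoc using sum_sign_chains[OF assms(2,4,5,1), of ?g] by simp
  also have "sign \<tau> * sign \<tau> = 1" by (simp add: sign_def)
  also have "of_int (1 * int (chains UNIV \<mu> ?g la)) = (skew_schur la \<mu> m :: 'a)"
    using assms by (simp add: skew_schur_eq)
  finally show "skew_schur la \<mu> m = (\<Sum>\<sigma> | \<sigma> permutes {..<clength la}.
      of_int (sign \<sigma>) * of_int (sign \<tau>) *
      (case perm_act \<sigma> la of None \<Rightarrow> 0 | Some \<alpha> \<Rightarrow> skew_dual_immaculate \<alpha> \<nu> m) :: 'a)"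
    by simp
qed

end
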